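(* Let $X$ be a Delone set in $\mathbb{R}^n$ that is either linearly repetitive or densely repetitive. Then $X$ has strict uniform patch frequencies. Moreover, if $X$ is linearly repetitive, then there is a constant $\delta>0$ depending only on $X$ such that for every patch $\mathcal{P}$ of $X$ (translated to the origin), with limiting frequency $f(\mathcal{P})$, $$\frac{n_{\mathcal{P}}(B(\mathbf{t};U))}{\kappa_n U^n}=f(\mathcal{P})+O(U^{-\delta})\quad\text{as }U\to\infty,$$ uniformly in $\mathbf{t}\in\mathbb{R}^n$, where the $O$-constant may depend on $\mathcal{P}$.
   Context: A Delone set in $\mathbb{R}^n$ is a set $X\subset\mathbb{R}^n$ for which there are $r,R>0$ such that each open ball of radius $r$ contains at most one point of $X$ and each closed ball of radius $R$ contains at least one point of $X$. $X$ is of finite type if $X-X$ meets every bounded set in a finite set. $B(\mathbf{x};T)$ is the closed ball of radius $T$ centered at $\mathbf{x}$, and $\kappa_n$ is the volume of the unit ball in $\mathbb{R}^n$. For $\mathbf{x}\in X$ the $T$-patch of $X$ at $\mathbf{x}$ is $X\cap B(\mathbf{x};T)$. $N_X(T)$ is the number of distinct sets $(X\cap B(\mathbf{x};T))-\mathbf{x}$, $\mathbf{x}\in X$. $X$ is repetitive if for each $T>0$ there is a finite $M>0$ such that every closed ball of radius $M$ in $\mathbb{R}^n$ contains, for every $\mathbf{y}\in X$, some $\mathbf{x}\in X$ with $(X\cap B(\mathbf{x};T))-\mathbf{x}=(X\cap B(\mathbf{y};T))-\mathbf{y}$; $M_X(T)$ denotes the least such $M$. (Repetitive Delone sets are automatically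 of finite type.) A repetitive $X$ is linearly repetitive if $M_X(T)=O(T)$ as $T\to\infty$, and densely repetitive if $M_X(T)=O(N_X(T)^{1/n})$ as $T\to\infty$. A $T$-patch of $X$ translated to the origin is a set $\mathcal{P}=(X\cap B(\mathbf{y};T))-\mathbf{y}$ with $\mathbf{y}\in X$. For such $\mathcal{P}$ (with its radius $T$) and a bounded region $D\subset\mathbb{R}^n$, $n_{\mathcal{P}}(D)$ is the number of points $\mathbf{x}\in X\cap D$ with $(X\cap B(\mathbf{x};T))-\mathbf{x}=\mathcal{P}$. $X$ has uniform patch frequencies if for every $T>0$ and every such $\mathcal{P}$ there is a number $f(\mathcal{P})$ with $n_{\mathcal{P}}(B(\mathbf{t};U))/(\kappa_nU^n)=f(\mathcal{P})+o(1)$ as $U\to\infty$, uniformly in $\mathbf{t}\in\mathbb{R}^n$. It has strict uniform patch frequencies if in addition $f(\mathcal{P})\neq 0$ for every patch $\mathcal{P}$ that occurs in $X$. *)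

theory Defs
  imports "HOL-Analysis.Analysis" "HOL-Library.Landau_Symbols"
begin

definition delone_set :: "(real ^ 'n) set \<Rightarrow> bool" where
  "delone_set X \<longleftrightarrow>
     (\<exists>r>0. \<exists>R>0.
        (\<forall>c. \<forall>x \<in> X \<inter> ball c r. \<forall>y \<in> X \<inter> ball c r. x = y) \<and>
        (\<forall>c. X \<inter> cball c R \<noteq> {}))"

definition centered_patch :: "(real ^ 'n) set \<Rightarrow> real \<Rightarrow> real ^ 'n \<Rightarrow> (real ^ 'n) set" where
  "centered_patch X T x = (\<lambda>z. z - x) ` (X \<inter> cball x T)"

definition centered_patches :: "(real ^ 'n) set \<Rightarrow> real \<Rightarrow> (real ^ 'n) set set" where
  "centered_patches X T = centered_patch X T ` X"

text \<open>\<open>N\<^sub>X(T)\<close>. For a repetitive Delone set the set of patches is finite, so the convention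
  that infinite sets have cardinality 0 plays no role.\<close>

definition patch_count :: "(real ^ 'n) set \<Rightarrow> real \<Rightarrow> nat" where
  "patch_count X T = card (centered_patches X T)"

definition repetitivity_bound :: "(real ^ 'n) set \<Rightarrow> real \<Rightarrow> real \<Rightarrow> bool" where
  "repetitivity_bound X T M \<longleftrightarrow> M > 0 \<and>
     (\<forall>c. \<forall>y\<in>X. \<exists>x \<in> X \<inter> cball c M. centered_patch X T x = centered_patch X T y)"

definition repetitive :: "(real ^ 'n) set \<Rightarrow> bool" where
  "repetitive X \<longleftrightarrow> (\<forall>T>0. \<exists>M. repetitivity_bound X T M)"

text \<open>\<open>M\<^sub>X(T)\<close>, the least admissible \<open>M\<close>. It is given as an infimum; the lemma
  \<open>repetitivity_function_least\<close> below shows that the infimum is attained.\<close>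

definition repetitivity_function :: "(real ^ 'n) set \<Rightarrow> real \<Rightarrow> real" where
  "repetitivity_function X T = Inf {M. repetitivity_bound X T M}"

definition linearly_repetitive :: "(real ^ 'n) set \<Rightarrow> bool" where
  "linearly_repetitive X \<longleftrightarrow>
     repetitive X \<and> repetitivity_function X \<in> O[at_top](\<lambda>T. T)"

definition densely_repetitive :: "(real ^ 'n) set \<Rightarrow> bool" where
  "densely_repetitive X \<longleftrightarrow>
     repetitive X \<and>
     repetitivity_function X \<in> O[at_top](\<lambda>T. real (patch_count X T) powr (1 / real CARD('n)))"

text \<open>\<open>n\<^sub>P(D)\<close>. The radius \<open>T\<close> is an explicit argument, because the same finite set \<open>P\<close>
  may be a patch for several radii, with different occurrences.\<close>

definition patch_occurrences ::
    "(real ^ 'n) set \<Rightarrow> real \<Rightarrow> (real ^ 'n) set \<Rightarrow> (real ^ 'n) set \<Rightarrow> nat" where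
  "patch_occurrences X T P D = card {x \<in> X \<inter> D. centered_patch X T x = P}"

definition patch_density ::
    "(real ^ 'n) set \<Rightarrow> real \<Rightarrow> (real ^ 'n) set \<Rightarrow> real \<Rightarrow> real ^ 'n \<Rightarrow> real" where
  "patch_density X T P U t =
     real (patch_occurrences X T P (cball t U)) /
       (measure lborel (ball (0 :: real ^ 'n) 1) * U ^ CARD('n))"

definition has_patch_frequency ::
    "(real ^ 'n) set \<Rightarrow> real \<Rightarrow> (real ^ 'n) set \<Rightarrow> real \<Rightarrow> bool" where
  "has_patch_frequency X T P f \<longleftrightarrow>
     uniform_limit UNIV (\<lambda>U t. patch_density X T P U t) (\<lambda>t. f) at_top"

definition uniform_patch_frequencies :: "(real ^ 'n) set \<Rightarrow> bool" where
  "uniform_patch_frequencies X \<longleftrightarrow>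
     (\<forall>T>0. \<forall>P \<in> centered_patches X T. \<exists>f. has_patch_frequency X T P f)"

definition strict_uniform_patch_frequencies :: "(real ^ 'n) set \<Rightarrow> bool" where
  "strict_uniform_patch_frequencies X \<longleftrightarrow>
     uniform_patch_frequencies X \<and>
     (\<forall>T>0. \<forall>P \<in> centered_patches X T. \<forall>f. has_patch_frequency X T P f \<longrightarrow> f \<noteq> 0)"

lemma repetitivity_function_least:
  fixes X :: "(real ^ 'n) set"
  assumes "delone_set X" "repetitive X" "T > 0"
  shows "repetitivity_bound X T (repetitivity_function X T)"
    and "\<And>M. repetitivity_bound X T M \<Longrightarrow> repetitivity_function X T \<le> M"
proof -
  let ?S = "{M. repetitivity_bound X T M}"
  obtain r where r: "r > 0"
    and rX: "\<And>c x y. x \<in> X \<inter> ball c r \<Longrightarrow> y \<in> X \<inter> ball c r \<Longrightarrow> x = y"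
    and ne: "X \<noteq> {}"
    using assms(1) unfolding delone_set_def by blast
  have disc: "x = y" if "x \<in> X" "y \<in> X" "dist y x < r" for x y
    using rX[of x x y] that r by (auto simp: dist_commute)
  have Sne: "?S \<noteq> {}"
    using assms(2,3) unfolding repetitive_def by auto
  have low: "r / 2 \<le> M" if "M \<in> ?S" for M
  proof -
    obtain x where x: "x \<in> X" using ne by blast
    obtain c where c: "dist x c = r / 2"
      using vector_choose_dist[of "r / 2" x] r by auto
    have "\<exists>z \<in> X \<inter> cball c M. centered_patch X T z = centered_patch X T x"
      using that x by (simp add: repetitivity_bound_def)
    then obtain z where z: "z \<in> X" "dist c z \<le> M" by auto
    show ?thesis
    proof (cases "z = x")
      case True
      then show ?thesis using z c by (simp add: dist_commute)
    next
      case False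
      then have "dist z x \<ge> r" using disc[of x z] x z by force
      moreover have "dist z x \<le> dist c z + dist x c"
        by (metis dist_commute dist_triangle)
      ultimately show ?thesis using z c by linarith
    qed
  qed
  have bdd: "bdd_below ?S" using low by (rule bdd_belowI)
  show le: "repetitivity_function X T \<le> M" if "repetitivity_bound X T M" for M
    unfolding repetitivity_function_def using that bdd by (auto intro: cInf_lower)
  have "r / 2 \<le> repetitivity_function X T"
    unfolding repetitivity_function_def using Sne low by (intro cInf_greatest) auto
  then have pos: "repetitivity_function X T > 0" using r by linarith
  have "\<exists>x \<in> X \<inter> cball c (repetitivity_function X T). centered_patch X T x = centered_patch X T y"
    if y: "y \<in> X" for c y
  proof -
    let ?F = "{x \<in> X. centered_patch X T x = centered_patch X T y}"
    have "closed ?F"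
      by (rule discrete_imp_closed[OF r]) (use disc in blast)
    moreover have "?F \<noteq> {}" using y by blast
    ultimately obtain x where x: "x \<in> ?F" "\<And>z. z \<in> ?F \<Longrightarrow> dist c x \<le> dist c z"
      using distance_attains_inf[of ?F c] by auto
    have "dist c x \<le> M" if "M \<in> ?S" for M
    proof -
      have "\<exists>z \<in> X \<inter> cball c M. centered_patch X T z = centered_patch X T y"
        using that y by (simp add: repetitivity_bound_def)
      then obtain z where "z \<in> ?F" "dist c z \<le> M" by auto
      then show ?thesis using x(2) by (meson order_trans)
    qed
    then have "dist c x \<le> repetitivity_function X T"
      unfolding repetitivity_function_def using Sne by (intro cInf_greatest) auto
    then show ?thesis using x by (auto simp: mem_cball)
  qed
  then show "repetitivity_bound X T (repetitivity_function X T)"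
    unfolding repetitivity_bound_def using pos by blast
qed

end

theory Submission
  imports Defs
begin

text \<open>
  Fix a patch and count its occurrences in half-open boxes. If all boxes with sides at least \<open>U\<close>
  have densities in \<open>[h, g]\<close>, then some box with sides in \<open>[U, 2 * U]\<close> has at most the mean density
  \<open>(g + h) / 2\<close>, or else the mean density is a new lower bound. In the first case linear repetitivity
  puts a translate of that box into every box of size \<open>L * U\<close>; the remainder can be cut into boxes with
  sides at least \<open>U\<close>, without boundary losses, so the upper bound drops by a fixed proportion of
  \<open>g - h\<close>. Hence \<open>g - h\<close> decays like a power of the size, with an exponent that depends only on \<open>L\<close>
  and the dimension. Averaging cubes of side \<open>sqrt V\<close> over a ball of radius \<open>V\<close> transfers the rate to balls.

  Dense repetitivity says that every patch of radius \<open>U + T\<close> has frequency at least a constant over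
  the number of such patches. A large ball of nearly maximal density consists mostly of balls of
  radius \<open>U\<close> of nearly maximal density, so at most one third of the patches of radius \<open>U + T\<close> have a
  density clearly below the maximum; likewise at most one third are clearly above the minimum.
  Hence maximum and minimum agree in the limit.

  Frequencies are positive because each ball of radius \<open>repetitivity_function X T\<close> contains every patch.
\<close>

subsection \<open>Packing and averaging\<close>

lemma power_card_eq: "V ^ CARD('n::finite) = V * V ^ (CARD('n) - 1)" for V :: real
  by (metis One_nat_def Suc_pred power_Suc zero_less_card_finite)

text \<open>Mean value bound for the volume of a thin shell: each term in the factorisation of
  \<open>a ^ m - b ^ m\<close> is at most \<open>a ^ (m - 1)\<close>.\<close>

lemma power_diff_le:
  fixes a b :: real
  assumes "0 \<le> b" "b \<le> a"
  shows "a ^ m - b ^ m \<le> real m * (a - b) * a ^ (m - 1)"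
proof -
  have "(\<Sum>i<m. b ^ (m - Suc i) * a ^ i) \<le> (\<Sum>i<m. a ^ (m - 1))"
  proof (rule sum_mono)
    fix i assume "i \<in> {..<m}"
    then have "a ^ (m - 1) = a ^ (m - Suc i) * a ^ i"
      by (simp flip: power_add)
    then show "b ^ (m - Suc i) * a ^ i \<le> a ^ (m - 1)"
      using assms by (simp add: mult_right_mono power_mono)
  qed
  then have "(a - b) * (\<Sum>i<m. b ^ (m - Suc i) * a ^ i) \<le> (a - b) * (\<Sum>i<m. a ^ (m - 1))"
    using assms by (intro mult_left_mono) auto
  then show ?thesis
    by (simp add: power_diff_sumr2 mult_ac)
qed

lemma fmeasurable_lborel_bounded:
  fixes A :: "'a::euclidean_space set"
  assumes "A \<in> sets borel" "bounded A"
  shows "A \<in> fmeasurable lborel"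
  using assms emeasure_bounded_finite[of A] by (auto simp: fmeasurable_def)

text \<open>Separation \<open>2 * r\<close> makes the open balls of radius \<open>r\<close> about
  the points disjoint; \<open>r \<le> 1\<close> lets \<open>r\<close> be absorbed into widths
  \<open>\<rho> \<ge> 1\<close>.\<close>

locale uniformly_discrete =
  fixes S :: "(real ^ 'n) set" and r :: real
  assumes r_pos: "0 < r" and r_le_1: "r \<le> 1"
    and separated: "x \<in> S \<Longrightarrow> y \<in> S \<Longrightarrow> x \<noteq> y \<Longrightarrow> 2 * r \<le> dist x y"
begin

abbreviation count_in :: "(real ^ 'n) set \<Rightarrow> real" where
  "count_in A \<equiv> real (card (S \<inter> A))"

lemma disjnt_balls: "pairwise (\<lambda>x y. disjnt (ball x r) (ball y r)) S"
proof (rule pairwiseI, unfold disjnt_iff, intro allI notI)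
  fix x y z assume xy: "x \<in> S" "y \<in> S" "x \<noteq> y" and z: "z \<in> ball x r \<and> z \<in> ball y r"
  from z have "dist x z < r" "dist y z < r" by auto
  then have "dist x y < 2 * r"
    using dist_triangle2[of x y z] by linarith
  with separated[OF xy] show False by simp
qed

lemma measure_disjoint_balls:
  assumes "finite G" "G \<subseteq> S"
  shows "measure lborel (\<Union>x\<in>G. ball x r) = real (card G) * (unit_ball_vol CARD('n) * r ^ CARD('n))"
proof -
  have "measure lborel (\<Union>x\<in>G. ball x r) = (\<Sum>x\<in>G. measure lborel (ball x r))"
    using assms disjnt_balls
    by (intro measure_UNION') (auto simp: pairwise_def intro: fmeasurable_lborel_bounded)
  then show ?thesis
    using r_pos by (simp add: content_ball)
qed

text \<open>Volumes of disjoint balls are compared. The same comparison bounds the size of every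
  finite subset, whence finiteness; \<open>card\<close> alone could not show it, being 0 on infinite
  sets.\<close>

lemma packing:
  assumes E: "E \<in> fmeasurable lborel" and sub: "\<And>x. x \<in> S \<Longrightarrow> x \<in> A \<Longrightarrow> ball x r \<subseteq> E"
  shows "finite (S \<inter> A)" and "count_in A * (unit_ball_vol CARD('n) * r ^ CARD('n)) \<le> measure lborel E"
proof -
  let ?v = "unit_ball_vol CARD('n) * r ^ CARD('n)"
  have v: "?v > 0" using r_pos by simp
  have *: "real (card G) * ?v \<le> measure lborel E" if "G \<subseteq> S \<inter> A" "finite G" for G
  proof -
    have "real (card G) * ?v = measure lborel (\<Union>x\<in>G. ball x r)"
      using that by (subst measure_disjoint_balls) auto
    also have "\<dots> \<le> measure lborel E"
      using that sub E by (intro measure_mono_fmeasurable sets.finite_UN) auto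
    finally show ?thesis .
  qed
  have "card G \<le> nat \<lceil>measure lborel E / ?v\<rceil>" if "G \<subseteq> S \<inter> A" "finite G" for G
  proof -
    have "real (card G) \<le> measure lborel E / ?v"
      using *[OF that] v by (simp add: field_simps)
    then show ?thesis by linarith
  qed
  then show "finite (S \<inter> A)"
    using finite_if_finite_subsets_card_bdd by blast
  then show "count_in A * ?v \<le> measure lborel E"
    using * by blast
qed

lemma finite_bounded:
  assumes "bounded A"
  shows "finite (S \<inter> A)"
proof -
  obtain c R where R: "A \<subseteq> cball c R"
    using assms by (metis bounded_subset_cball)
  show ?thesis
  proof (rule packing)
    show "ball c (R + r) \<in> fmeasurable lborel"
      by (simp add: fmeasurable_lborel_bounded)
    show "ball x r \<subseteq> ball c (R + r)" if "x \<in> A" for x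
    proof -
      have "dist c x \<le> R" using R that by auto
      then show ?thesis by (simp add: ball_subset_ball_iff dist_commute)
    qed
  qed
qed

text \<open>The boundary layer of a ball: only here can a displacement of length at most
  \<open>\<rho>\<close> carry a point across the sphere of radius \<open>V\<close>.\<close>

definition annulus :: "real ^ 'n \<Rightarrow> real \<Rightarrow> real \<Rightarrow> (real ^ 'n) set" where
  "annulus t V \<rho> = {x. V - \<rho> \<le> dist t x \<and> dist t x \<le> V + \<rho>}"

text \<open>The balls of radius \<open>r\<close> about these points fit into a shell of thickness at
  most \<open>4 * \<rho>\<close>, so the count is small against the volume of the ball when
  \<open>\<rho>\<close> is small against \<open>V\<close>.\<close>

lemma annulus_count_le:
  assumes "1 \<le> \<rho>" "\<rho> \<le> V"
  shows "finite (S \<inter> annulus t V \<rho>)"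
    and "count_in (annulus t V \<rho>) \<le> 4 * CARD('n) * 3 ^ (CARD('n) - 1) / r ^ CARD('n) * \<rho> * V ^ (CARD('n) - 1)"
proof -
  let ?d = "CARD('n)"
  \<comment> \<open>\<open>max 0\<close> covers \<open>V - \<rho> < r\<close>. As
    \<open>r \<le> 1 \<le> \<rho> \<le> V\<close>, both \<open>a \<le> 3 * V\<close> and
    \<open>a - b \<le> 4 * \<rho>\<close> hold.\<close>
  define a b where "a = V + \<rho> + r" and "b = max 0 (V - \<rho> - r)"
  define E where "E = cball t a - ball t b"
  have ab: "0 \<le> b" "b \<le> a" "a \<le> 3 * V" "a - b \<le> 4 * \<rho>" "0 \<le> a"
    using assms r_pos r_le_1 by (auto simp: a_def b_def)
  have fm: "cball t a \<in> fmeasurable lborel" "ball t b \<in> fmeasurable lborel"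
    by (auto intro: fmeasurable_lborel_bounded)
  have "ball t b \<subseteq> cball t a" using ab by auto
  then have E: "E \<in> fmeasurable lborel" "measure lborel E = unit_ball_vol CARD('n) * (a ^ ?d - b ^ ?d)"
    using fm ab unfolding E_def
    by (auto simp: measurable_measure_Diff content_ball content_cball algebra_simps)
  have sub: "ball x r \<subseteq> E" if "x \<in> annulus t V \<rho>" for x
  proof
    fix y assume "y \<in> ball x r"
    then have "dist x y < r" by simp
    moreover have "dist t y \<le> dist t x + dist x y" "dist t x \<le> dist t y + dist x y"
      by (rule dist_triangle, rule dist_triangle2)
    ultimately show "y \<in> E"
      using that by (auto simp: annulus_def E_def a_def b_def not_less)
  qed
  show "finite (S \<inter> annulus t V \<rho>)"
    by (rule packing(1)[OF E(1)]) (rule sub)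
  have "count_in (annulus t V \<rho>) * (unit_ball_vol CARD('n) * r ^ ?d) \<le> unit_ball_vol CARD('n) * (a ^ ?d - b ^ ?d)"
    using packing(2)[OF E(1), of "annulus t V \<rho>"] sub E(2) by auto
  then have "count_in (annulus t V \<rho>) * r ^ ?d \<le> a ^ ?d - b ^ ?d"
    using unit_ball_vol_pos[of "real ?d"] by (simp add: mult.left_commute del: unit_ball_vol_pos)
  also have "\<dots> \<le> real ?d * (a - b) * a ^ (?d - 1)"
    using ab by (intro power_diff_le)
  also have "\<dots> \<le> real ?d * (4 * \<rho>) * (3 * V) ^ (?d - 1)"
    using ab assms by (intro mult_mono power_mono) auto
  finally show "count_in (annulus t V \<rho>) \<le> 4 * ?d * 3 ^ (?d - 1) / r ^ ?d * \<rho> * V ^ (?d - 1)"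
    using r_pos by (simp add: field_simps power_mult_distrib)
qed

text \<open>Both \<open>k\<close> times the number of points in the ball and the integral count, with different
  boundary effects, the pairs of a point \<open>x \<in> S\<close> and a translation vector \<open>z\<close> with \<open>x \<in> z + K\<close>.\<close>

lemma double_counting:
  fixes t :: "real ^ 'n"
  assumes sets: "\<And>x. {z. x - z \<in> K} \<in> sets borel"
    and k: "\<And>x. measure lborel {z. x - z \<in> K} = k"
    and K: "K \<subseteq> cball 0 \<rho>" and \<rho>: "1 \<le> \<rho>" "\<rho> \<le> V"
  defines "I \<equiv> (\<lambda>z. indicator (cball t V) z * count_in {x. x - z \<in> K})"
  shows "integrable lborel I"
    and "\<bar>k * count_in (cball t V) - (\<integral>z. I z \<partial>lborel)\<bar> \<le> k * count_in (annulus t V \<rho>)"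
proof -
  let ?B = "cball t V"
  define W where "W = S \<inter> cball t (V + \<rho>)"
  define A where "A = (\<lambda>x. {z. x - z \<in> K})"
  have finW: "finite W"
    unfolding W_def by (intro finite_bounded) simp
  have near: "dist x z \<le> \<rho>" if "z \<in> A x" for x z
    using that K by (auto simp: A_def dist_norm subset_iff)
  have fmB: "?B \<in> fmeasurable lborel"
    by (simp add: fmeasurable_lborel_bounded)
  have A_sub: "A x \<subseteq> cball x \<rho>" for x using near by auto
  have fmA: "A x \<in> fmeasurable lborel" for x
    using sets[of x] bounded_subset[OF bounded_cball A_sub]
    by (simp add: A_def fmeasurable_lborel_bounded)
  from fmA fmB have fm: "A x \<inter> ?B \<in> fmeasurable lborel" for x
    by (rule fmeasurable.Int)
  have kA: "measure lborel (A x) = k" for x using k by (simp add: A_def)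
  then have k0: "k \<ge> 0" by (metis measure_nonneg)
  \<comment> \<open>Translations \<open>z\<close> in the ball reach only points within
    \<open>V + \<rho>\<close> of \<open>t\<close>, so the integrand is a finite sum of indicators
    over the fixed set \<open>W\<close>.\<close>
  have I: "I z = (\<Sum>x\<in>W. indicator (A x \<inter> ?B) z)" for z
  proof (cases "z \<in> ?B")
    case True
    have "dist t x \<le> V + \<rho>" if "x - z \<in> K" for x
    proof -
      have "dist x z \<le> \<rho>" using near[of z x] that by (simp add: A_def)
      moreover have "dist t x \<le> dist t z + dist x z"
        by (rule dist_triangle2)
      ultimately show ?thesis using True by auto
    qed
    then have "S \<inter> {x. x - z \<in> K} = {x \<in> W. x - z \<in> K}"
      by (auto simp: W_def)
    moreover have "(\<Sum>x\<in>W. indicator (A x \<inter> ?B) z) = (\<Sum>x\<in>W. if x - z \<in> K then 1 else 0 :: real)"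
      using True by (intro sum.cong) (auto simp: A_def indicator_def)
    ultimately show ?thesis
      using True finW by (simp add: I_def sum.If_cases Int_def)
  qed (auto simp: I_def indicator_def)
  have int: "integrable lborel (\<lambda>z. indicator (A x \<inter> ?B) z :: real)" for x
    using fm[of x] by (intro integrable_real_indicator) (auto simp: fmeasurable_def)
  then show "integrable lborel I"
    unfolding I by (intro Bochner_Integration.integrable_sum int)
  have "(\<integral>z. I z \<partial>lborel) = (\<Sum>x\<in>W. \<integral>z. indicator (A x \<inter> ?B) z \<partial>lborel)"
    unfolding I by (intro Bochner_Integration.integral_sum int)
  also have "\<dots> = (\<Sum>x\<in>W. measure lborel (A x \<inter> ?B))"
    by simp
  finally have eq1: "(\<integral>z. I z \<partial>lborel) = (\<Sum>x\<in>W. measure lborel (A x \<inter> ?B))" .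
  have "S \<inter> ?B = {x \<in> W. x \<in> ?B}" using \<rho> by (auto simp: W_def)
  then have eq2: "k * count_in ?B = (\<Sum>x\<in>W. if x \<in> ?B then k else 0)"
    using finW by (simp add: sum.If_cases Int_def)
  have "\<bar>k * count_in ?B - (\<integral>z. I z \<partial>lborel)\<bar>
      \<le> (\<Sum>x\<in>W. \<bar>(if x \<in> ?B then k else 0) - measure lborel (A x \<inter> ?B)\<bar>)"
    unfolding eq1 eq2 sum_subtractf[symmetric] by (rule sum_abs)
  \<comment> \<open>A point of \<open>W\<close> outside the annulus is closer than
    \<open>V - \<rho>\<close> to \<open>t\<close>; then \<open>A x\<close> lies in the ball and the
    two terms cancel. In the annulus both terms lie between 0 and \<open>k\<close>.\<close>
  also have "\<dots> \<le> (\<Sum>x\<in>W. if x \<in> annulus t V \<rho> then k else 0)"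
  proof (rule sum_mono)
    fix x assume x: "x \<in> W"
    show "\<bar>(if x \<in> ?B then k else 0) - measure lborel (A x \<inter> ?B)\<bar>
        \<le> (if x \<in> annulus t V \<rho> then k else 0)"
    proof (cases "x \<in> annulus t V \<rho>")
      case True
      have "measure lborel (A x \<inter> ?B) \<le> measure lborel (A x)"
        using fmeasurableD[OF fm] fmA by (intro measure_mono_fmeasurable) auto
      then show ?thesis
        using True kA[of x] k0 measure_nonneg[of lborel "A x \<inter> ?B"] by auto
    next
      case False
      with x have d: "dist t x < V - \<rho>"
        by (auto simp: W_def annulus_def)
      have "A x \<subseteq> ?B"
      proof
        fix z assume "z \<in> A x"
        then have "dist x z \<le> \<rho>" by (rule near)
        then show "z \<in> ?B" using d dist_triangle[of t z x] by simp
      qed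
      then have "A x \<inter> ?B = A x" by auto
      then show ?thesis
        using False d \<rho> kA[of x] by simp
    qed
  qed
  also have "\<dots> = k * count_in (annulus t V \<rho>)"
  proof -
    have "S \<inter> annulus t V \<rho> = {x \<in> W. x \<in> annulus t V \<rho>}" by (auto simp: W_def annulus_def)
    then show ?thesis using finW by (simp add: sum.If_cases Int_def)
  qed
  finally show "\<bar>k * count_in ?B - (\<integral>z. I z \<partial>lborel)\<bar> \<le> k * count_in (annulus t V \<rho>)" .
qed

end

subsection \<open>Additive functions of boxes\<close>

text \<open>Half-open, so that a cut by a coordinate hyperplane gives two boxes of the same kind,
  with no point lost or counted twice.\<close>

definition hobox :: "real ^ 'n \<Rightarrow> real ^ 'n \<Rightarrow> (real ^ 'n) set" where
  "hobox a b = {x. \<forall>i. a $ i \<le> x $ i \<and> x $ i < b $ i}"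

definition box_vol :: "real ^ 'n \<Rightarrow> real ^ 'n \<Rightarrow> real" where
  "box_vol a b = (\<Prod>i\<in>UNIV. b $ i - a $ i)"

text \<open>Serves to cut boxes: changing the upper corner keeps the lower piece, changing the lower
  corner keeps the upper piece.\<close>

definition set_coord :: "real ^ 'n \<Rightarrow> 'n \<Rightarrow> real \<Rightarrow> real ^ 'n" where
  "set_coord a i c = (\<chi> j. if j = i then c else a $ j)"

lemma set_coord_nth [simp]: "set_coord a i c $ j = (if j = i then c else a $ j)"
  by (simp add: set_coord_def)

definition box_additive :: "(real ^ 'n \<Rightarrow> real ^ 'n \<Rightarrow> real) \<Rightarrow> bool" where
  "box_additive \<phi> \<longleftrightarrow>
     (\<forall>a b i c. a $ i \<le> c \<longrightarrow> c \<le> b $ i \<longrightarrow> \<phi> a b = \<phi> a (set_coord b i c) + \<phi> (set_coord a i c) b)"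

lemma box_additiveD:
  "box_additive \<phi> \<Longrightarrow> a $ i \<le> c \<Longrightarrow> c \<le> b $ i \<Longrightarrow> \<phi> a b = \<phi> a (set_coord b i c) + \<phi> (set_coord a i c) b"
  unfolding box_additive_def by blast

lemma box_additive_lincomb:
  fixes \<phi> \<psi> :: "real ^ 'n \<Rightarrow> real ^ 'n \<Rightarrow> real"
  shows "box_additive \<phi> \<Longrightarrow> box_additive \<psi> \<Longrightarrow> box_additive (\<lambda>a b. u * \<phi> a b + v * \<psi> a b)"
  unfolding box_additive_def
proof (intro allI impI)
  fix a b :: "real ^ 'n" and i c
  assume 1: "\<forall>a b i c. a $ i \<le> c \<longrightarrow> c \<le> b $ i \<longrightarrow> \<phi> a b = \<phi> a (set_coord b i c) + \<phi> (set_coord a i c) b"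
    and 2: "\<forall>a b i c. a $ i \<le> c \<longrightarrow> c \<le> b $ i \<longrightarrow> \<psi> a b = \<psi> a (set_coord b i c) + \<psi> (set_coord a i c) b"
    and c: "a $ i \<le> c" "c \<le> b $ i"
  have "\<phi> a b = \<phi> a (set_coord b i c) + \<phi> (set_coord a i c) b"
    using 1 c by blast
  moreover have "\<psi> a b = \<psi> a (set_coord b i c) + \<psi> (set_coord a i c) b"
    using 2 c by blast
  ultimately show "u * \<phi> a b + v * \<psi> a b
      = u * \<phi> a (set_coord b i c) + v * \<psi> a (set_coord b i c)
        + (u * \<phi> (set_coord a i c) b + v * \<psi> (set_coord a i c) b)"
    by (simp only: distrib_left add_ac)
qed

lemma box_additive_vol: "box_additive box_vol"
  unfolding box_additive_def
proof (intro allI impI)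
  fix a b :: "real ^ 'n" and i c
  have *: "box_vol p q = (q $ i - p $ i) * (\<Prod>j\<in>UNIV - {i}. q $ j - p $ j)" for p q :: "real ^ 'n"
    unfolding box_vol_def by (rule prod.remove) auto
  show "box_vol a b = box_vol a (set_coord b i c) + box_vol (set_coord a i c) b"
    by (simp add: * algebra_simps cong: prod.cong_simp)
qed

definition sides_ge :: "real \<Rightarrow> real ^ 'n \<Rightarrow> real ^ 'n \<Rightarrow> bool" where
  "sides_ge U a b \<longleftrightarrow> (\<forall>i. U \<le> b $ i - a $ i)"

definition sides_within :: "real \<Rightarrow> real \<Rightarrow> real ^ 'n \<Rightarrow> real ^ 'n \<Rightarrow> bool" where
  "sides_within U V a b \<longleftrightarrow> (\<forall>i. U \<le> b $ i - a $ i \<and> b $ i - a $ i \<le> V)"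

lemma box_vol_ge:
  fixes a b :: "real ^ 'n"
  assumes "sides_ge U a b" "0 \<le> U"
  shows "U ^ CARD('n) \<le> box_vol a b"
proof -
  have "(\<Prod>i\<in>(UNIV :: 'n set). U) \<le> box_vol a b"
    unfolding box_vol_def using assms by (intro prod_mono) (auto simp: sides_ge_def)
  then show ?thesis by simp
qed

lemma box_vol_le:
  fixes a b :: "real ^ 'n"
  assumes "sides_within U V a b" "0 \<le> U"
  shows "box_vol a b \<le> V ^ CARD('n)"
proof -
  have "box_vol a b \<le> (\<Prod>i\<in>(UNIV :: 'n set). V)"
    unfolding box_vol_def
  proof (intro prod_mono conjI)
    fix i :: 'n
    have "U \<le> b $ i - a $ i" "b $ i - a $ i \<le> V"
      using assms(1) by (auto simp: sides_within_def)
    then show "0 \<le> b $ i - a $ i" "b $ i - a $ i \<le> V" using assms(2) by auto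
  qed
  then show ?thesis by simp
qed

text \<open>Slabs of thickness \<open>U\<close> are cut off until all sides are at most \<open>2 * U\<close>.\<close>

lemma box_additive_nonneg:
  assumes add: "box_additive \<phi>" and U: "0 < U"
    and nonneg: "\<And>a b. sides_within U (2 * U) a b \<Longrightarrow> 0 \<le> \<phi> a b"
    and ab: "sides_ge U a b"
  shows "0 \<le> \<phi> a b"
  using ab
\<comment> \<open>The measure adds up how many slabs of thickness \<open>U\<close> fit along each
  axis; a cut lowers one summand and leaves the others alone.\<close>
proof (induction "\<Sum>i\<in>UNIV. nat \<lfloor>(b $ i - a $ i) / U\<rfloor>" arbitrary: a b rule: less_induct)
  case less
  define m where "m = (\<lambda>a b :: real ^ 'a. \<Sum>i\<in>UNIV. nat \<lfloor>(b $ i - a $ i) / U\<rfloor>)"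
  have IH: "0 \<le> \<phi> p q" if "m p q < m a b" "sides_ge U p q" for p q
    using less.hyps that unfolding m_def by blast
  show ?case
  proof (cases "\<forall>i. b $ i - a $ i \<le> 2 * U")
    case True
    then show ?thesis using less.prems nonneg by (auto simp: sides_ge_def sides_within_def)
  next
    case False
    then obtain i where i: "2 * U < b $ i - a $ i" by (auto simp: not_le)
    \<comment> \<open>As this side exceeds \<open>2 * U\<close>, slab and remainder both keep sides
      at least \<open>U\<close>, and each is shorter than the original side by at least
      \<open>U\<close>.\<close>
    define c where "c = a $ i + U"
    have decr: "m p q < m a b"
      if eq: "\<And>j. j \<noteq> i \<Longrightarrow> q $ j - p $ j = b $ j - a $ j"
        and le: "q $ i - p $ i \<le> b $ i - a $ i - U" for p q
      unfolding m_def
    proof (rule sum_strict_mono_ex1)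
      have fl: "\<lfloor>(b $ i - a $ i - U) / U\<rfloor> = \<lfloor>(b $ i - a $ i) / U\<rfloor> - 1"
        using U by (simp add: diff_divide_distrib)
      have "2 < (b $ i - a $ i) / U" using i U by (simp add: field_simps)
      then have "2 \<le> \<lfloor>(b $ i - a $ i) / U\<rfloor>" by linarith
      moreover have "\<lfloor>(q $ i - p $ i) / U\<rfloor> \<le> \<lfloor>(b $ i - a $ i - U) / U\<rfloor>"
        using le U by (intro floor_mono divide_right_mono) auto
      ultimately have lt: "nat \<lfloor>(q $ i - p $ i) / U\<rfloor> < nat \<lfloor>(b $ i - a $ i) / U\<rfloor>"
        using fl by linarith
      then show "\<exists>j\<in>UNIV. nat \<lfloor>(q $ j - p $ j) / U\<rfloor> < nat \<lfloor>(b $ j - a $ j) / U\<rfloor>" by blast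
      show "\<forall>j\<in>UNIV. nat \<lfloor>(q $ j - p $ j) / U\<rfloor> \<le> nat \<lfloor>(b $ j - a $ j) / U\<rfloor>"
      proof
        fix j show "nat \<lfloor>(q $ j - p $ j) / U\<rfloor> \<le> nat \<lfloor>(b $ j - a $ j) / U\<rfloor>"
          by (cases "j = i") (use lt eq in \<open>auto simp: less_imp_le\<close>)
      qed
    qed simp
    have "0 \<le> \<phi> a (set_coord b i c)"
      by (rule IH, rule decr) (use i less.prems in \<open>auto simp: c_def sides_ge_def\<close>)
    moreover have "0 \<le> \<phi> (set_coord a i c) b"
      by (rule IH, rule decr) (use i less.prems in \<open>auto simp: c_def sides_ge_def\<close>)
    moreover have "\<phi> a b = \<phi> a (set_coord b i c) + \<phi> (set_coord a i c) b"
      by (rule box_additiveD[OF add]) (use i U in \<open>auto simp: c_def\<close>)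
    ultimately show ?thesis by simp
  qed
qed

text \<open>The outer box is cut down to the inner one axis by axis. By the margin, all pieces
  removed have sides at least \<open>U\<close>, so \<open>\<phi>\<close> is nonnegative on
  them.\<close>

lemma box_additive_mono:
  fixes a b p q :: "real ^ 'n"
  assumes add: "box_additive \<phi>" and U: "0 < U"
    and nonneg: "\<And>a b. sides_ge U a b \<Longrightarrow> 0 \<le> \<phi> a b"
    and pq: "sides_ge U p q"
    and margin: "\<And>i. a $ i + U \<le> p $ i" "\<And>i. q $ i + U \<le> b $ i"
  shows "\<phi> p q \<le> \<phi> a b"
proof -
  \<comment> \<open>\<open>I\<close> holds the axes already cut; inserting \<open>i\<close> removes
    the pieces above \<open>q $ i\<close> and below \<open>p $ i\<close>.\<close>
  have "\<phi> (\<chi> i. if i \<in> I then p $ i else a $ i) (\<chi> i. if i \<in> I then q $ i else b $ i) \<le> \<phi> a b"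
    if "finite I" for I
    using that
  proof (induction I rule: finite_induct)
    case empty
    show ?case by simp
  next
    case (insert i I)
    define a' b' where "a' = (\<chi> i. if i \<in> I then p $ i else a $ i)"
      and "b' = (\<chi> i. if i \<in> I then q $ i else b $ i)"
    have s: "U \<le> q $ j - p $ j" for j using pq by (simp add: sides_ge_def)
    have ord: "a $ j + U \<le> p $ j" "p $ j + U \<le> q $ j" "q $ j + U \<le> b $ j" for j
      using margin[of j] s[of j] by auto
    have ord': "U \<le> b $ j - a $ j" for j
      using ord[of j] U by linarith
    let ?q = "set_coord b' i (q $ i)"
    have "\<phi> a' b' = \<phi> a' ?q + \<phi> (set_coord a' i (q $ i)) b'"
      using insert.hyps ord[of i] U by (intro box_additiveD[OF add]) (auto simp: a'_def b'_def)
    moreover have "\<phi> a' ?q = \<phi> a' (set_coord ?q i (p $ i)) + \<phi> (set_coord a' i (p $ i)) ?q"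
      using insert.hyps ord[of i] U by (intro box_additiveD[OF add]) (auto simp: a'_def b'_def)
    moreover have "0 \<le> \<phi> (set_coord a' i (q $ i)) b'"
      using insert.hyps ord[of i] s ord' by (intro nonneg) (auto simp: a'_def b'_def sides_ge_def)
    moreover have "0 \<le> \<phi> a' (set_coord ?q i (p $ i))"
      using insert.hyps ord[of i] s ord' by (intro nonneg) (auto simp: a'_def b'_def sides_ge_def)
    moreover have "set_coord a' i (p $ i) = (\<chi> j. if j \<in> insert i I then p $ j else a $ j)"
      and "?q = (\<chi> j. if j \<in> insert i I then q $ j else b $ j)"
      by (auto simp: vec_eq_iff a'_def b'_def)
    ultimately show ?case
      using insert.IH by (simp flip: a'_def b'_def)
  qed
  from this[of UNIV] show ?thesis by simp
qed

section \<open>Density bounds on boxes and their contraction\<close>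

definition density_bounds :: "(real ^ 'n \<Rightarrow> real ^ 'n \<Rightarrow> real) \<Rightarrow> real \<Rightarrow> real \<Rightarrow> real \<Rightarrow> bool" where
  "density_bounds N U h g \<longleftrightarrow>
     (\<forall>a b. sides_ge U a b \<longrightarrow> h * box_vol a b \<le> N a b \<and> N a b \<le> g * box_vol a b)"

text \<open>Only the value of \<open>N\<close> has to recur, but at distance \<open>U\<close> from
  every face: this is the margin that \<open>box_additive_mono\<close> asks for.\<close>

definition recurrent_boxes :: "(real ^ 'n \<Rightarrow> real ^ 'n \<Rightarrow> real) \<Rightarrow> real \<Rightarrow> real \<Rightarrow> bool" where
  "recurrent_boxes N L U \<longleftrightarrow>
     (\<forall>p q a b. sides_within U (2 * U) p q \<longrightarrow> sides_ge (L * U) a b \<longrightarrow>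
        (\<exists>v. N (p + v) (q + v) = N p q \<and>
           (\<forall>i. a $ i + U \<le> (p + v) $ i \<and> (q + v) $ i + U \<le> b $ i)))"

lemma sides_ge_mono: "sides_ge V a b \<Longrightarrow> U \<le> V \<Longrightarrow> sides_ge U a b"
  unfolding sides_ge_def by (meson order_trans)

lemma sides_within_imp_ge: "sides_within U V a b \<Longrightarrow> sides_ge U a b"
  by (simp add: sides_ge_def sides_within_def)

lemma density_bounds_le:
  fixes N :: "real ^ 'n \<Rightarrow> real ^ 'n \<Rightarrow> real"
  assumes "density_bounds N U h g" "0 < U"
  shows "h \<le> g"
proof -
  define b :: "real ^ 'n" where "b = (\<chi> i. U)"
  have b: "sides_ge U 0 b" by (simp add: sides_ge_def b_def)
  then have "0 < box_vol 0 b"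
    using box_vol_ge[OF b] assms(2) by (smt (verit) zero_less_power)
  moreover have "h * box_vol 0 b \<le> g * box_vol 0 b"
    using assms(1) b unfolding density_bounds_def by (meson order_trans)
  ultimately show ?thesis by simp
qed

text \<open>If some box of size about \<open>U\<close> has at most the mean density \<open>(g + h) / 2\<close>, then a translate
  of it sits in every box of size \<open>L * U\<close> and pulls the upper bound down; otherwise the mean
  density is a new lower bound.\<close>

lemma density_contraction:
  fixes N :: "real ^ 'n \<Rightarrow> real ^ 'n \<Rightarrow> real"
  assumes add: "box_additive N" and U: "0 < U" and L: "1 \<le> L"
    and rec: "recurrent_boxes N L U" and bnd: "density_bounds N U h g"
  shows "\<exists>h' g'. h \<le> h' \<and> g' \<le> g \<and> g' - h' \<le> (1 - 1 / (2 * (2 * L) ^ CARD('n))) * (g - h) \<and>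
    density_bounds N (L * U) h' g'"
proof -
  let ?d = "CARD('n)"
  \<comment> \<open>Half the ratio of \<open>U ^ ?d\<close>, the least volume of the sparse box, to
    \<open>(2 * (L * U)) ^ ?d\<close>, the greatest volume of a test box around it. The half comes
    from \<open>g - m = (g - h) / 2\<close>.\<close>
  define w where "w = 1 / (2 * (2 * L) ^ ?d)"
  define m where "m = (g + h) / 2"
  have hg: "h \<le> g" using density_bounds_le[OF bnd U] .
  have "1 \<le> (2 * L) ^ ?d" using L by (intro one_le_power) auto
  then have w: "0 < w" "w \<le> 1 / 2" by (auto simp: w_def field_simps)
  have LU: "U \<le> L * U" "0 < L * U" using L U by (auto simp: mult_le_cancel_right1)
  have bndL: "h * box_vol a b \<le> N a b" "N a b \<le> g * box_vol a b" if "sides_ge (L * U) a b" for a b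
    using bnd sides_ge_mono[OF that LU(1)] by (auto simp: density_bounds_def)
  show ?thesis
  proof (cases "\<exists>p q. sides_within U (2 * U) p q \<and> N p q < m * box_vol p q")
    case False
    have "0 \<le> 1 * N a b + (- m) * box_vol a b" if "sides_ge (L * U) a b" for a b
      by (rule box_additive_nonneg[OF box_additive_lincomb[OF add box_additive_vol] U
            _ sides_ge_mono[OF that LU(1)]]) (use False in \<open>auto simp: not_less\<close>)
    then have "density_bounds N (L * U) m g"
      using bndL by (auto simp: density_bounds_def)
    moreover have "g - m \<le> (1 - w) * (g - h)"
    proof -
      have "g - m = 1 / 2 * (g - h)" by (simp add: m_def field_simps)
      also have "\<dots> \<le> (1 - w) * (g - h)" using w hg by (intro mult_right_mono) auto
      finally show ?thesis .
    qed
    moreover have "h \<le> m" using hg by (simp add: m_def)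
    ultimately show ?thesis unfolding w_def by blast
  next
    case True
    then obtain p q where pq: "sides_within U (2 * U) p q" "N p q < m * box_vol p q" by blast
    \<comment> \<open>The deficit against the upper bound. It is nonnegative on boxes with sides at
      least \<open>U\<close>, so a box inherits the deficit of the sparse box inside it.\<close>
    define \<phi> where "\<phi> = (\<lambda>a b. g * box_vol a b + (- 1) * N a b)"
    define g' where "g' = g - w * (g - h)"
    have \<phi>: "box_additive \<phi>"
      unfolding \<phi>_def by (rule box_additive_lincomb[OF box_additive_vol add])
    \<comment> \<open>The bounded size of these boxes makes the deficit a fixed proportion of their
      volume; \<open>box_additive_nonneg\<close> then covers all larger boxes.\<close>
    have step: "0 \<le> g' * box_vol a b + (- 1) * N a b" if ab: "sides_within (L * U) (2 * (L * U)) a b" for a b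
    proof -
      obtain v where v: "N (p + v) (q + v) = N p q"
        "\<And>i. a $ i + U \<le> (p + v) $ i" "\<And>i. (q + v) $ i + U \<le> b $ i"
        using rec pq(1) sides_within_imp_ge[OF ab] unfolding recurrent_boxes_def by blast
      have "\<phi> (p + v) (q + v) \<le> \<phi> a b"
      proof (rule box_additive_mono[OF \<phi> U])
        show "0 \<le> \<phi> a b" if "sides_ge U a b" for a b
          using bnd that by (auto simp: \<phi>_def density_bounds_def)
        show "sides_ge U (p + v) (q + v)"
          using pq(1) by (auto simp: sides_ge_def sides_within_def)
      qed (use v in auto)
      moreover have "\<phi> (p + v) (q + v) = g * box_vol p q - N p q"
        using v(1) by (simp add: \<phi>_def box_vol_def)
      moreover have "w * (g - h) * box_vol a b \<le> (g - m) * box_vol p q"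
      proof -
        have "w * (g - h) * box_vol a b \<le> w * (g - h) * (2 * (L * U)) ^ ?d"
          using w hg box_vol_le[OF ab] LU by (intro mult_left_mono) auto
        also have "\<dots> = (g - m) * U ^ ?d"
        proof -
          have "(2 * (L * U)) ^ ?d = (2 * L) ^ ?d * U ^ ?d"
            by (simp add: mult.assoc power_mult_distrib)
          moreover have "w * (2 * L) ^ ?d = 1 / 2"
            using L by (simp add: w_def)
          ultimately have "w * (2 * (L * U)) ^ ?d = 1 / 2 * U ^ ?d"
            by (simp only: mult.assoc[symmetric])
          moreover have "w * (g - h) * (2 * (L * U)) ^ ?d = w * (2 * (L * U)) ^ ?d * (g - h)"
            by (simp only: mult_ac)
          moreover have "g - m = 1 / 2 * (g - h)" by (simp add: m_def field_simps)
          ultimately show ?thesis by (simp only: mult_ac)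
        qed
        also have "\<dots> \<le> (g - m) * box_vol p q"
          using hg U box_vol_ge[OF sides_within_imp_ge[OF pq(1)]]
          by (intro mult_left_mono) (auto simp: m_def)
        finally show ?thesis .
      qed
      ultimately show ?thesis
        using pq(2) by (simp add: \<phi>_def g'_def algebra_simps)
    qed
    have "0 \<le> g' * box_vol a b + (- 1) * N a b" if ab: "sides_ge (L * U) a b" for a b
      by (rule box_additive_nonneg[OF box_additive_lincomb[OF box_additive_vol add] LU(2) step ab])
    then have "density_bounds N (L * U) h g'"
      using bndL by (auto simp: density_bounds_def)
    moreover have "g' - h \<le> (1 - w) * (g - h)" "g' \<le> g"
      using w hg by (auto simp: g'_def algebra_simps)
    ultimately show ?thesis unfolding w_def by blast
  qed
qed

text \<open>Contraction at the scales \<open>L ^ k * U0\<close> gives nested density intervals of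
  length at most \<open>(1 - w) ^ k * G\<close>. The exponent solves
  \<open>L powr (- \<delta>) = 1 - w\<close>, which turns this into a power of the scale.\<close>

lemma density_rate:
  fixes N :: "real ^ 'n \<Rightarrow> real ^ 'n \<Rightarrow> real" and L :: real
  defines "w \<equiv> 1 / (2 * (2 * L) ^ CARD('n))"
  defines "\<delta> \<equiv> - ln (1 - w) / ln L"
  assumes add: "box_additive N" and U0: "0 < U0" and L: "2 \<le> L"
    and rec: "\<And>U. U0 \<le> U \<Longrightarrow> recurrent_boxes N L U" and bnd: "density_bounds N U0 0 G"
  shows "\<exists>f C. 0 \<le> C \<and> (\<forall>s a b. U0 \<le> s \<longrightarrow> sides_ge s a b \<longrightarrow>
    \<bar>N a b - f * box_vol a b\<bar> \<le> C * s powr (- \<delta>) * box_vol a b)"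
proof -
  have "1 \<le> (2 * L) ^ CARD('n)" using L by (intro one_le_power) auto
  then have w: "0 < w" "w \<le> 1 / 2" by (auto simp: w_def field_simps)
  have \<delta>: "\<delta> > 0" using w L by (simp add: \<delta>_def divide_neg_pos)
  define Q where "Q = (\<lambda>k (h, g). density_bounds N (L ^ k * U0) h g \<and> g - h \<le> (1 - w) ^ k * G)"
  \<comment> \<open>Dependent choice keeps the nesting along with \<open>Q\<close>, so that a single
    \<open>f\<close> lies in all intervals.\<close>
  have "\<exists>s. \<forall>k. Q k (s k) \<and> (fst (s k) \<le> fst (s (Suc k)) \<and> snd (s (Suc k)) \<le> snd (s k))"
  proof (rule dependent_nat_choice)
    show "\<exists>x. Q 0 x"
      by (rule exI[of _ "(0, G)"]) (use bnd in \<open>simp add: Q_def\<close>)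
    fix x k assume "Q k x"
    then obtain h g where x: "x = (h, g)" "density_bounds N (L ^ k * U0) h g" "g - h \<le> (1 - w) ^ k * G"
      by (cases x) (auto simp: Q_def)
    have U: "U0 \<le> L ^ k * U0" using L U0 by (simp add: mult_le_cancel_right1)
    obtain h' g' where hg': "h \<le> h'" "g' \<le> g" "g' - h' \<le> (1 - w) * (g - h)"
        "density_bounds N (L * (L ^ k * U0)) h' g'"
      using density_contraction[OF add _ _ rec[OF U] x(2)] U0 U L unfolding w_def by auto
    moreover have "(1 - w) * (g - h) \<le> (1 - w) ^ Suc k * G"
      using w x(3) by (simp add: mult.assoc mult_left_mono)
    ultimately have "Q (Suc k) (h', g')" by (simp add: Q_def mult.assoc)
    then show "\<exists>y. Q (Suc k) y \<and> fst x \<le> fst y \<and> snd y \<le> snd x"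
      using hg' x(1) by (intro exI[of _ "(h', g')"]) auto
  qed
  then obtain s where s: "\<And>k. Q k (s k)"
      "\<And>k. fst (s k) \<le> fst (s (Suc k))" "\<And>k. snd (s (Suc k)) \<le> snd (s k)" by blast
  define h g where "h = (\<lambda>k. fst (s k))" and "g = (\<lambda>k. snd (s k))"
  have Q: "density_bounds N (L ^ k * U0) (h k) (g k)" "g k - h k \<le> (1 - w) ^ k * G" for k
    using s(1)[of k] by (auto simp: Q_def h_def g_def split: prod.splits)
  have mono: "incseq h" "decseq g"
    using s by (auto simp: h_def g_def intro: incseq_SucI decseq_SucI)
  have hg: "h j \<le> g k" for j k
  proof -
    have "h j \<le> h (max j k)" "g (max j k) \<le> g k"
      using mono by (auto simp: incseq_def decseq_def)
    moreover have "h (max j k) \<le> g (max j k)"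
      by (rule density_bounds_le[OF Q(1)]) (use L U0 in auto)
    ultimately show ?thesis by linarith
  qed
  define f where "f = (SUP j. h j)"
  have f: "h k \<le> f" "f \<le> g k" for k
    unfolding f_def using hg by (auto intro!: cSUP_upper cSUP_least bdd_aboveI2[of _ _ "g 0"])
  have G: "0 \<le> G" using density_bounds_le[OF bnd U0] .
  \<comment> \<open>\<open>1 / (1 - w)\<close> pays for rounding the number of contractions down,
    \<open>U0 powr \<delta>\<close> for replacing \<open>s / U0\<close> by \<open>s\<close>.\<close>
  define C where "C = G / (1 - w) * U0 powr \<delta>"
  have "\<bar>N a b - f * box_vol a b\<bar> \<le> C * s powr (- \<delta>) * box_vol a b"
    if s: "U0 \<le> s" and ab: "sides_ge s a b" for s a b
  proof -
    \<comment> \<open>The last scale \<open>L ^ k * U0\<close> not above \<open>s\<close>: its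
      bounds apply to the box, and the next scale exceeding \<open>s\<close> yields the
      rate.\<close>
    define k where "k = nat \<lfloor>log L (s / U0)\<rfloor>"
    have s1: "1 \<le> s / U0" and s0: "0 < s" using s U0 by auto
    have l0: "0 \<le> log L (s / U0)" using s1 L by simp
    have k: "real k \<le> log L (s / U0)" "log L (s / U0) < real (Suc k)"
      using l0 unfolding k_def by linarith+
    have "L ^ k \<le> s / U0"
      using k(1) s1 L by (simp add: le_log_iff powr_realpow)
    then have "L ^ k * U0 \<le> s" using U0 by (simp add: field_simps)
    then have b: "h k * box_vol a b \<le> N a b" "N a b \<le> g k * box_vol a b"
      using Q(1)[of k] sides_ge_mono[OF ab] by (auto simp: density_bounds_def)
    have "s / U0 < L ^ Suc k"
      using k(2) s1 L by (simp add: log_less_iff powr_realpow del: power_Suc of_nat_Suc)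
    have vol: "0 \<le> box_vol a b"
      using box_vol_ge[OF ab] s0 by (smt (verit) zero_less_power)
    have "(h k - f) * box_vol a b \<ge> - ((g k - h k) * box_vol a b)"
      "(g k - f) * box_vol a b \<le> (g k - h k) * box_vol a b"
      using f[of k] vol by (auto simp: mult_right_mono simp flip: mult_minus_left)
    then have "\<bar>N a b - f * box_vol a b\<bar> \<le> (g k - h k) * box_vol a b"
      using b by (simp add: algebra_simps abs_le_iff)
    also have "\<dots> \<le> (1 - w) ^ k * G * box_vol a b"
      using Q(2)[of k] vol by (intro mult_right_mono)
    also have "\<dots> \<le> C * s powr (- \<delta>) * box_vol a b"
    proof (intro mult_right_mono vol)
      have "ln (1 - w) * (log L (s / U0)) \<ge> ln (1 - w) * real (Suc k)"
        using k(2) w by (intro mult_left_mono_neg) auto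
      moreover have "ln (1 - w) * log L (s / U0) = - \<delta> * ln (s / U0)"
        using L by (simp add: \<delta>_def log_def)
      ultimately have "exp (ln (1 - w) * real (Suc k)) \<le> exp (- \<delta> * ln (s / U0))" by simp
      moreover have "exp (ln (1 - w) * real (Suc k)) = (1 - w) ^ Suc k"
        using w by (simp add: exp_of_nat2_mult del: of_nat_Suc)
      moreover have "exp (- \<delta> * ln (s / U0)) = s powr (- \<delta>) * U0 powr \<delta>"
        using s0 U0 by (simp add: powr_def ln_div algebra_simps flip: exp_add)
      ultimately have "(1 - w) ^ Suc k \<le> s powr (- \<delta>) * U0 powr \<delta>" by (simp only:)
      then have "(1 - w) ^ k * (1 - w) \<le> s powr (- \<delta>) * U0 powr \<delta>" by (simp add: mult.commute)
      then have "(1 - w) ^ k \<le> s powr (- \<delta>) * U0 powr \<delta> / (1 - w)"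
        using w by (simp add: field_simps)
      from mult_right_mono[OF this G] show "(1 - w) ^ k * G \<le> C * s powr (- \<delta>)"
        by (simp add: C_def field_simps)
    qed
    finally show ?thesis .
  qed
  moreover have "0 \<le> C" using G w by (simp add: C_def)
  ultimately show ?thesis by blast
qed

subsection \<open>Linear repetitivity\<close>

lemma hobox_translate: "(\<lambda>y. y + v) ` hobox p q = hobox (p + v) (q + v)"
proof -
  have "y \<in> (\<lambda>y. y + v) ` hobox p q" if "y \<in> hobox (p + v) (q + v)" for y
    by (rule image_eqI[of _ _ "y - v"]) (use that in \<open>auto simp: hobox_def algebra_simps\<close>)
  then show ?thesis by (auto simp: hobox_def)
qed

lemma hobox_subset_cball:
  fixes a b :: "real ^ 'n" and W :: real
  assumes "\<And>i. b $ i - a $ i \<le> W"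
  shows "hobox a b \<subseteq> cball a (CARD('n) * W)"
proof
  fix y assume y: "y \<in> hobox a b"
  have "norm (y - a) \<le> (\<Sum>i\<in>UNIV. \<bar>(y - a) $ i\<bar>)" by (rule norm_le_l1_cart)
  also have "\<dots> \<le> (\<Sum>i\<in>(UNIV :: 'n set). W)"
  proof (rule sum_mono)
    fix i :: 'n
    show "\<bar>(y - a) $ i\<bar> \<le> W"
      using y assms[of i] by (auto simp: hobox_def dest!: spec[of _ i])
  qed
  finally show "y \<in> cball a (CARD('n) * W)"
    by (simp add: dist_norm norm_minus_commute)
qed

lemma bounded_hobox: "bounded (hobox a b)"
proof -
  have "hobox a b \<subseteq> cbox a b"
    by (auto simp: hobox_def mem_box_cart less_imp_le)
  then show ?thesis using bounded_cbox bounded_subset by blast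
qed

text \<open>These are the translations whose cube contains \<open>x\<close>, so the measure is the
  weight of one point in the averaging. The set is squeezed between an open and a closed box of
  equal volume.\<close>

lemma measure_reflected_cube:
  fixes x :: "real ^ 'n"
  assumes s: "0 < s"
  defines "A \<equiv> {z. x - z \<in> hobox 0 (\<chi> i. s)}"
  shows "A \<in> sets borel" and "measure lborel A = s ^ CARD('n)"
proof -
  let ?l = "\<chi> i. x $ i - s"
  have A: "A = (\<Inter>i. {z. x $ i - s < z $ i} \<inter> {z. z $ i \<le> x $ i})"
    by (auto simp: A_def hobox_def less_diff_eq diff_less_eq add.commute)
  show meas: "A \<in> sets borel"
    unfolding A
    by (intro sets.finite_INT sets.Int borel_open borel_closed
        open_halfspace_component_gt_cart closed_halfspace_component_le_cart) auto
  have sub: "box ?l x \<subseteq> A" "A \<subseteq> cbox ?l x"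
    by (auto simp: A mem_box_cart less_imp_le)
  have vol: "measure lborel (cbox ?l x) = s ^ CARD('n)"
    using s by (simp add: content_cbox_if_cart interval_eq_empty_cart not_less)
  have "A \<in> fmeasurable lborel"
    using meas bounded_subset[OF bounded_cbox sub(2)] by (intro fmeasurable_lborel_bounded)
  then have "measure lborel (box ?l x) \<le> measure lborel A" "measure lborel A \<le> measure lborel (cbox ?l x)"
    using sub meas by (auto intro!: measure_mono_fmeasurable fmeasurable_lborel_bounded)
  then show "measure lborel A = s ^ CARD('n)"
    using vol by (simp add: measure_lborel_box_eq measure_lborel_cbox_eq)
qed

lemma integral_cball_const:
  fixes t :: "real ^ 'n"
  shows "integrable lborel (\<lambda>z. indicator (cball t V) z * c :: real)"
    and "0 \<le> V \<Longrightarrow> (\<integral>z. indicator (cball t V) z * c \<partial>lborel) = unit_ball_vol CARD('n) * V ^ CARD('n) * c"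
proof -
  have "emeasure lborel (cball t V) < \<infinity>"
    using emeasure_bounded_finite[of "cball t V"] by simp
  then show "integrable lborel (\<lambda>z. indicator (cball t V) z * c :: real)"
    by (intro integrable_mult_left integrable_real_indicator) auto
  show "0 \<le> V \<Longrightarrow> (\<integral>z. indicator (cball t V) z * c \<partial>lborel) = unit_ball_vol CARD('n) * V ^ CARD('n) * c"
    by (simp add: content_cball)
qed

section \<open>Point counts in boxes and the passage to balls\<close>

context uniformly_discrete
begin

lemma box_additive_count: "box_additive (\<lambda>a b. count_in (hobox a b))"
  unfolding box_additive_def
proof (intro allI impI)
  fix a b :: "real ^ 'n" and i c
  assume c: "a $ i \<le> c" "c \<le> b $ i"
  let ?A = "S \<inter> hobox a (set_coord b i c)" and ?B = "S \<inter> hobox (set_coord a i c) b"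
  have "x \<in> hobox a b \<longleftrightarrow> x \<in> hobox a (set_coord b i c) \<or> x \<in> hobox (set_coord a i c) b" for x
  proof -
    have *: "x \<in> hobox p q \<longleftrightarrow> (p $ i \<le> x $ i \<and> x $ i < q $ i) \<and> (\<forall>j. j \<noteq> i \<longrightarrow> p $ j \<le> x $ j \<and> x $ j < q $ j)" for p q
      unfolding hobox_def by auto
    show ?thesis unfolding *[of a b] *[of a "set_coord b i c"] *[of "set_coord a i c" b] using c by auto
  qed
  then have "S \<inter> hobox a b = ?A \<union> ?B" by blast
  moreover have "?A \<inter> ?B = {}" by (auto simp: hobox_def dest!: spec[of _ i])
  ultimately show "count_in (hobox a b) = count_in (hobox a (set_coord b i c)) + count_in (hobox (set_coord a i c) b)"
    by (simp add: card_Un_disjoint finite_bounded bounded_hobox)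
qed

lemma count_cball_le:
  assumes "0 \<le> V"
  shows "count_in (cball t V) \<le> ((V + r) / r) ^ CARD('n)"
proof -
  have "count_in (cball t V) * (unit_ball_vol CARD('n) * r ^ CARD('n)) \<le> measure lborel (cball t (V + r))"
  proof (rule packing)
    show "ball x r \<subseteq> cball t (V + r)" if "x \<in> cball t V" for x
      using that by (simp add: ball_subset_cball_iff dist_commute)
  qed (simp add: fmeasurable_lborel_bounded)
  then have "count_in (cball t V) * r ^ CARD('n) \<le> (V + r) ^ CARD('n)"
    using assms r_pos by (simp add: content_cball mult.left_commute)
  then show ?thesis using r_pos by (simp add: power_divide field_simps)
qed

lemma count_mono: "A \<subseteq> B \<Longrightarrow> bounded B \<Longrightarrow> count_in A \<le> count_in B"
  by (auto intro!: card_mono finite_bounded)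

text \<open>Starting interval of the iteration: packing bounds the count in boxes with sides in
  \<open>[U, 2 * U]\<close>, and additivity extends the bound to larger ones.\<close>

lemma initial_density_bounds:
  assumes U: "0 < U"
  shows "\<exists>G. density_bounds (\<lambda>a b. count_in (hobox a b)) U 0 G"
proof -
  let ?W = "CARD('n) * (2 * U)"
  define c where "c = ((?W + r) / r) ^ CARD('n)"
  define G where "G = c / U ^ CARD('n)"
  have c: "0 \<le> c" unfolding c_def using U r_pos by (intro zero_le_power) auto
  have step: "0 \<le> G * box_vol a b + (- 1) * count_in (hobox a b)"
    if "sides_within U (2 * U) a b" for a b
  proof -
    have "count_in (hobox a b) \<le> count_in (cball a ?W)"
      using that by (intro count_mono hobox_subset_cball) (auto simp: sides_within_def)
    also have "\<dots> \<le> c"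
      unfolding c_def using U by (intro count_cball_le) auto
    also have "c = G * U ^ CARD('n)" using U by (simp add: G_def)
    also have "\<dots> \<le> G * box_vol a b"
      using box_vol_ge[OF sides_within_imp_ge[OF that]] c U by (intro mult_left_mono) (auto simp: G_def)
    finally show ?thesis by simp
  qed
  have "0 \<le> G * box_vol a b + (- 1) * count_in (hobox a b)" if "sides_ge U a b" for a b
    by (rule box_additive_nonneg[OF box_additive_lincomb[OF box_additive_vol box_additive_count] U step that])
  then have "density_bounds (\<lambda>a b. count_in (hobox a b)) U 0 G"
    by (auto simp: density_bounds_def)
  then show ?thesis by blast
qed

text \<open>Cubes of side \<open>s = sqrt V\<close> are averaged over the ball. Per volume, the
  cubes err by the order of \<open>s powr (- \<delta>) = V powr (- (\<delta> / 2))\<close>, the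
  boundary layer by that of \<open>s / V = V powr (- (1 / 2))\<close>; the slower decay
  prevails.\<close>

lemma ball_rate_from_boxes:
  assumes \<delta>: "0 < \<delta>" and C: "0 \<le> C" and U0: "0 < U0"
    and rate: "\<And>s a b. U0 \<le> s \<Longrightarrow> sides_ge s a b \<Longrightarrow>
      \<bar>count_in (hobox a b) - f * box_vol a b\<bar> \<le> C * s powr (- \<delta>) * box_vol a b"
  shows "\<exists>C'. \<forall>\<^sub>F V in at_top. \<forall>t.
    \<bar>count_in (cball t V) / (unit_ball_vol CARD('n) * V ^ CARD('n)) - f\<bar> \<le> C' * V powr (- min (\<delta> / 2) (1 / 2))"
proof -
  let ?d = "CARD('n)"
  let ?\<kappa> = "unit_ball_vol (real ?d)"
  define Ca where "Ca = 4 * ?d * 3 ^ (?d - 1) / r ^ ?d"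
  have Ca: "0 \<le> Ca" using r_pos by (simp add: Ca_def)
  have \<kappa>: "0 < ?\<kappa>" by simp
  then have \<kappa>_nz: "?\<kappa> \<noteq> 0" by (metis less_irrefl)
  define C' where "C' = C + Ca * ?d / ?\<kappa>"
  have "\<bar>count_in (cball t V) / (?\<kappa> * V ^ ?d) - f\<bar> \<le> C' * V powr (- min (\<delta> / 2) (1 / 2))"
    if V: "V \<ge> max (max 1 (U0\<^sup>2)) ((real ?d)\<^sup>2)" for V t
  proof -
    define s where "s = sqrt V"
    have V1: "1 \<le> V" using V by simp
    \<comment> \<open>\<open>U0 \<le> s\<close> makes the box rate available, and
      \<open>?d \<le> s\<close> keeps the boundary width \<open>?d * s\<close> at most
      \<open>s * s = V\<close>.\<close>
    have s: "1 \<le> s" "U0 \<le> s" "real ?d \<le> s" "s * s = V"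
      using V U0 real_le_rsqrt by (auto simp: s_def)
    define K where "K = hobox 0 (\<chi> i. s :: real ^ 'n)"
    define I where "I = (\<lambda>z. indicator (cball t V) z * count_in {x. x - z \<in> K})"
    have K: "K \<subseteq> cball 0 (?d * s)"
      unfolding K_def by (intro hobox_subset_cball) simp
    have "1 \<le> real ?d" by (simp add: Suc_le_eq)
    then have \<rho>: "1 \<le> ?d * s" "?d * s \<le> V"
      using s mult_mono[of 1 "real ?d" 1 s] mult_right_mono[of "real ?d" s s] by auto
    have cube: "{z. x - z \<in> K} \<in> sets borel" "measure lborel {z. x - z \<in> K} = s ^ ?d" for x
      unfolding K_def using s(1) by (auto intro!: measure_reflected_cube)
    have dc: "integrable lborel I"
      "\<bar>s ^ ?d * count_in (cball t V) - (\<integral>z. I z \<partial>lborel)\<bar> \<le> s ^ ?d * count_in (annulus t V (?d * s))"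
      using double_counting[OF cube K \<rho>, of t] unfolding I_def by blast+
    have ann: "count_in (annulus t V (?d * s)) \<le> Ca * (?d * s) * V ^ (?d - 1)"
      unfolding Ca_def using \<rho> by (intro annulus_count_le)
    define e where "e = C * s powr (- \<delta>)"
    have e: "0 \<le> e" using C by (simp add: e_def)
    have cnt: "\<bar>count_in {x. x - z \<in> K} - f * s ^ ?d\<bar> \<le> e * s ^ ?d" for z
    proof -
      have "{x. x - z \<in> K} = hobox z (z + (\<chi> i. s))"
        by (auto simp: K_def hobox_def algebra_simps)
      moreover have "box_vol z (z + (\<chi> i. s)) = s ^ ?d" by (simp add: box_vol_def)
      ultimately show ?thesis
        using rate[OF s(2), of z "z + (\<chi> i. s)"] by (simp add: sides_ge_def e_def)
    qed
    have int: "integrable lborel (\<lambda>z. indicator (cball t V) z * c)" for c :: real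
      by (rule integral_cball_const)
    have intv: "(\<integral>z. indicator (cball t V) z * c \<partial>lborel) = ?\<kappa> * V ^ ?d * c" for c :: real
      using V1 by (intro integral_cball_const) simp
    have "(\<integral>z. I z \<partial>lborel) \<le> ?\<kappa> * V ^ ?d * ((f + e) * s ^ ?d)"
      unfolding intv[symmetric] using cnt
      by (intro integral_mono dc int) (auto simp: I_def indicator_def abs_le_iff algebra_simps)
    moreover have "?\<kappa> * V ^ ?d * ((f - e) * s ^ ?d) \<le> (\<integral>z. I z \<partial>lborel)"
      unfolding intv[symmetric] using cnt
      by (intro integral_mono dc int) (auto simp: I_def indicator_def abs_le_iff algebra_simps)
    ultimately have *: "\<bar>(\<integral>z. I z \<partial>lborel) - s ^ ?d * (?\<kappa> * V ^ ?d * f)\<bar> \<le> s ^ ?d * (?\<kappa> * V ^ ?d * e)"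
      by (simp add: abs_le_iff algebra_simps)
    have "\<bar>s ^ ?d * count_in (cball t V) - s ^ ?d * (?\<kappa> * V ^ ?d * f)\<bar>
        \<le> s ^ ?d * (?\<kappa> * V ^ ?d * e) + s ^ ?d * (Ca * (?d * s) * V ^ (?d - 1))"
    proof -
      have "s ^ ?d * count_in (annulus t V (?d * s)) \<le> s ^ ?d * (Ca * (?d * s) * V ^ (?d - 1))"
        using ann s(1) by (intro mult_left_mono) auto
      then show ?thesis using * dc(2) by linarith
    qed
    then have "s ^ ?d * \<bar>count_in (cball t V) - ?\<kappa> * V ^ ?d * f\<bar>
        \<le> s ^ ?d * (?\<kappa> * V ^ ?d * e + Ca * (?d * s) * V ^ (?d - 1))"
      using s(1) by (simp add: abs_mult distrib_left flip: right_diff_distrib)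
    then have *: "\<bar>count_in (cball t V) - ?\<kappa> * V ^ ?d * f\<bar> \<le> ?\<kappa> * V ^ ?d * e + Ca * (?d * s) * V ^ (?d - 1)"
      using s(1) by (simp add: mult_le_cancel_left)
    have pos: "0 < ?\<kappa> * V ^ ?d" using V1 by simp
    have "count_in (cball t V) / (?\<kappa> * V ^ ?d) - f = (count_in (cball t V) - ?\<kappa> * V ^ ?d * f) / (?\<kappa> * V ^ ?d)"
      by (simp only: diff_divide_distrib nonzero_mult_div_cancel_left[OF less_imp_neq[OF pos, symmetric]])
    then have "\<bar>count_in (cball t V) / (?\<kappa> * V ^ ?d) - f\<bar>
        = \<bar>count_in (cball t V) - ?\<kappa> * V ^ ?d * f\<bar> / (?\<kappa> * V ^ ?d)"
      using pos by (simp only: abs_divide abs_of_pos)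
    also have "\<dots> \<le> (?\<kappa> * V ^ ?d * e + Ca * (?d * s) * V ^ (?d - 1)) / (?\<kappa> * V ^ ?d)"
      using * pos by (intro divide_right_mono) auto
    also have "\<dots> = e + Ca * ?d / ?\<kappa> * (s / V)"
    proof -
      have "(?\<kappa> * (V * W) * e + Ca * (?d * s) * W) / (?\<kappa> * (V * W)) = e + Ca * ?d / ?\<kappa> * (s / V)"
        if "W \<noteq> 0" for W
        using \<kappa>_nz V1 that by (simp add: field_simps)
      moreover have "V ^ ?d = V * V ^ (?d - 1)"
        by (rule power_card_eq)
      moreover have "V ^ (?d - 1) \<noteq> 0" using V1 by simp
      ultimately show ?thesis by metis
    qed
    also have "\<dots> \<le> C' * V powr (- min (\<delta> / 2) (1 / 2))"
    proof -
      have "s = V powr (1 / 2)" using V1 by (simp add: s_def powr_half_sqrt)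
      then have "s powr (- \<delta>) = V powr (- (\<delta> / 2))" "s / V = V powr (- (1 / 2))"
        using V1 by (auto simp: powr_powr powr_minus_divide field_simps simp flip: powr_add)
      moreover have "V powr (- (\<delta> / 2)) \<le> V powr (- min (\<delta> / 2) (1 / 2))"
        "V powr (- (1 / 2)) \<le> V powr (- min (\<delta> / 2) (1 / 2))"
        using V1 by (auto intro!: powr_mono)
      moreover have "0 \<le> Ca * ?d / ?\<kappa>"
        using Ca \<kappa> by (intro divide_nonneg_pos mult_nonneg_nonneg) auto
      ultimately have "C * s powr (- \<delta>) \<le> C * V powr (- min (\<delta> / 2) (1 / 2))"
        "Ca * ?d / ?\<kappa> * (s / V) \<le> Ca * ?d / ?\<kappa> * V powr (- min (\<delta> / 2) (1 / 2))"
        using C by (simp_all only: mult_left_mono)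
      then show ?thesis by (simp add: C'_def e_def distrib_right)
    qed
    finally show ?thesis .
  qed
  then show ?thesis
    unfolding eventually_at_top_linorder by blast
qed

end

section \<open>Patches and their occurrences under translation\<close>

lemma mem_centered_patch: "w \<in> centered_patch X T x \<longleftrightarrow> x + w \<in> X \<and> norm w \<le> T"
proof -
  have "w \<in> centered_patch X T x \<longleftrightarrow> x + w \<in> X \<inter> cball x T"
    unfolding centered_patch_def by (auto intro: image_eqI[of _ _ "x + w"])
  then show ?thesis by (simp add: dist_norm)
qed

text \<open>Translation by \<open>x' - x\<close> carries \<open>X\<close> in
  \<open>cball x T'\<close> onto \<open>X\<close> in \<open>cball x' T'\<close>. The condition on
  \<open>y\<close> places its whole \<open>T\<close>-ball inside \<open>cball x T'\<close>.\<close>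

lemma patch_transfer:
  assumes eq: "centered_patch X T' x = centered_patch X T' x'"
  shows "dist x z \<le> T' \<Longrightarrow> z \<in> X \<longleftrightarrow> z + (x' - x) \<in> X"
    and "dist x y + T \<le> T' \<Longrightarrow> centered_patch X T (y + (x' - x)) = centered_patch X T y"
proof -
  show *: "z \<in> X \<longleftrightarrow> z + (x' - x) \<in> X" if "dist x z \<le> T'" for z
  proof -
    have "z - x \<in> centered_patch X T' x \<longleftrightarrow> z - x \<in> centered_patch X T' x'" using eq by simp
    then show ?thesis using that by (simp add: mem_centered_patch dist_norm norm_minus_commute algebra_simps)
  qed
  show "centered_patch X T (y + (x' - x)) = centered_patch X T y" if y: "dist x y + T \<le> T'"
  proof (rule set_eqI)
    fix w
    show "w \<in> centered_patch X T (y + (x' - x)) \<longleftrightarrow> w \<in> centered_patch X T y"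
    proof (cases "norm w \<le> T")
      case True
      then have "dist x (y + w) \<le> T'"
        using y dist_triangle[of x "y + w" y] by (simp add: dist_norm)
      from *[OF this] show ?thesis using True by (simp add: mem_centered_patch algebra_simps)
    qed (simp add: mem_centered_patch)
  qed
qed

locale delone_patch =
  fixes X :: "(real ^ 'n) set" and r R T :: real and P :: "(real ^ 'n) set"
  assumes r_pos: "0 < r" and r_le_1: "r \<le> 1"
    and X_separated: "x \<in> X \<Longrightarrow> y \<in> X \<Longrightarrow> x \<noteq> y \<Longrightarrow> 2 * r \<le> dist x y"
    and R_pos: "0 < R" and X_dense: "\<exists>x\<in>X. dist c x \<le> R"
    and T_pos: "0 < T" and P_patch: "P \<in> centered_patches X T"
begin

definition occ :: "(real ^ 'n) set" where
  "occ = {x \<in> X. centered_patch X T x = P}"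

sublocale X: uniformly_discrete X r
  using r_pos r_le_1 X_separated by unfold_locales

text \<open>Unprefixed, so that \<open>count_in\<close> counts occurrences of \<open>P\<close>;
  facts on all points of \<open>X\<close> carry the prefix \<open>X\<close>.\<close>

sublocale uniformly_discrete occ r
  using X_separated by unfold_locales (auto simp: occ_def r_pos r_le_1)

lemma patch_density_eq:
  "patch_density X T P U t = count_in (cball t U) / (unit_ball_vol CARD('n) * U ^ CARD('n))"
proof -
  have "occ \<inter> cball t U = {x \<in> X \<inter> cball t U. centered_patch X T x = P}"
    by (auto simp: occ_def)
  then show ?thesis by (simp add: patch_density_def patch_occurrences_def content_ball)
qed

text \<open>Being an occurrence depends only on the \<open>T\<close>-ball about the point, which the
  larger patch contains for all points of \<open>D\<close>.\<close>

lemma count_transfer: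
  assumes eq: "centered_patch X T' x = centered_patch X T' x'"
    and D: "\<And>y. y \<in> D \<Longrightarrow> dist x y + T \<le> T'"
  shows "count_in ((\<lambda>y. y + (x' - x)) ` D) = count_in D"
proof -
  have "y \<in> occ \<longleftrightarrow> y + (x' - x) \<in> occ" if "y \<in> D" for y
    using patch_transfer(1)[OF eq, of y] patch_transfer(2)[OF eq D[OF that]] D[OF that] T_pos
    by (auto simp: occ_def)
  then have "occ \<inter> (\<lambda>y. y + (x' - x)) ` D = (\<lambda>y. y + (x' - x)) ` (occ \<inter> D)" by auto
  then show ?thesis by (simp add: card_image inj_on_def)
qed

text \<open>Each point of \<open>cball t (V - M)\<close> has an occurrence within \<open>M\<close>,
  which lies in \<open>cball t V\<close>. So the \<open>M\<close>-balls about these occurrences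
  cover the smaller ball, and volumes are compared.\<close>

lemma patch_frequent:
  assumes rep: "repetitivity_bound X T' M" and x: "x \<in> X" and V: "M \<le> V"
  shows "((V - M) / M) ^ CARD('n) \<le> card {y \<in> X \<inter> cball t V. centered_patch X T' y = centered_patch X T' x}"
proof -
  define Y where "Y = {y \<in> X \<inter> cball t V. centered_patch X T' y = centered_patch X T' x}"
  have M: "0 < M" using rep by (simp add: repetitivity_bound_def)
  have fin: "finite Y"
    by (rule finite_subset[OF _ X.finite_bounded[of "cball t V"]]) (auto simp: Y_def)
  have "cball t (V - M) \<subseteq> (\<Union>y\<in>Y. cball y M)"
  proof
    fix z assume z: "z \<in> cball t (V - M)"
    obtain y where y: "y \<in> X" "dist z y \<le> M" "centered_patch X T' y = centered_patch X T' x"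
      using rep x unfolding repetitivity_bound_def by (metis IntE mem_cball)
    then have "dist t y \<le> V" using z dist_triangle[of t y z] by simp
    then show "z \<in> (\<Union>y\<in>Y. cball y M)"
      using y by (auto simp: Y_def dist_commute)
  qed
  then have "measure lborel (cball t (V - M)) \<le> measure lborel (\<Union>y\<in>Y. cball y M)"
    using fin by (intro measure_mono_fmeasurable fmeasurable_lborel_bounded) auto
  also have "\<dots> \<le> (\<Sum>y\<in>Y. measure lborel (cball y M))"
    using fin by (intro measure_UNION_le) auto
  finally have "(V - M) ^ CARD('n) \<le> card Y * M ^ CARD('n)"
    using V M by (simp add: content_cball mult.left_commute)
  then show ?thesis using M by (simp add: Y_def power_divide field_simps)
qed

text \<open>For \<open>V \<ge> 2 * M\<close> there are at least
  \<open>(V / (2 * M)) ^ CARD('n)\<close> occurrences; divided by the volume this is a positive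
  constant, which bounds the limit below.\<close>

lemma patch_frequency_pos:
  assumes rep: "repetitivity_bound X T M" and f: "has_patch_frequency X T P f"
  shows "0 < f"
proof -
  let ?\<kappa> = "unit_ball_vol (real CARD('n))"
  define c where "c = (1 / (2 * M)) ^ CARD('n) / ?\<kappa>"
  have M: "0 < M" using rep by (simp add: repetitivity_bound_def)
  obtain x where x: "x \<in> X" "P = centered_patch X T x"
    using P_patch by (auto simp: centered_patches_def)
  have "c \<le> patch_density X T P V 0" if V: "2 * M \<le> V" for V
  proof -
    have "(V / (2 * M)) ^ CARD('n) \<le> ((V - M) / M) ^ CARD('n)"
      using M V by (intro power_mono) (auto simp: field_simps)
    also have "\<dots> \<le> count_in (cball 0 V)"
    proof -
      have "occ \<inter> cball 0 V = {y \<in> X \<inter> cball 0 V. centered_patch X T y = centered_patch X T x}"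
        by (auto simp: occ_def simp flip: x(2))
      then show ?thesis using patch_frequent[OF rep x(1), of V 0] V M by simp
    qed
    finally have *: "(V / (2 * M)) ^ CARD('n) \<le> count_in (cball 0 V)" .
    have "c = (V / (2 * M)) ^ CARD('n) / (?\<kappa> * V ^ CARD('n))"
      using V M by (simp add: c_def power_divide)
    also have "\<dots> \<le> count_in (cball 0 V) / (?\<kappa> * V ^ CARD('n))"
      using * V M by (intro divide_right_mono) auto
    finally show ?thesis by (simp add: patch_density_eq)
  qed
  then have "\<forall>\<^sub>F V in at_top. c \<le> patch_density X T P V 0"
    unfolding eventually_at_top_linorder by blast
  moreover have "((\<lambda>V. patch_density X T P V 0) \<longlongrightarrow> f) at_top"
    using f unfolding has_patch_frequency_def by (rule tendsto_uniform_limitI) simp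
  ultimately have "c \<le> f"
    by (intro tendsto_lowerbound[of _ f at_top]) auto
  moreover have "0 < c" using M by (simp add: c_def)
  ultimately show ?thesis by simp
qed

text \<open>A point \<open>x\<close> of \<open>X\<close> near the corner \<open>p\<close> has a
  patch that shows all occurrences in the small box. The patch recurs near the middle
  \<open>m\<close> of the big box and carries the small box along.\<close>

lemma recurrent_boxes_count:
  assumes rep: "\<And>T'. T1 \<le> T' \<Longrightarrow> repetitivity_bound X T' (c * T')"
    and U: "R + T \<le> U" "T1 \<le> U"
  shows "recurrent_boxes (\<lambda>a b. count_in (hobox a b)) (2 * c * (1 + 2 * CARD('n)) + 8) U"
  unfolding recurrent_boxes_def
proof (intro allI impI)
  let ?L = "2 * c * (1 + 2 * CARD('n)) + 8"
  fix p q a b :: "real ^ 'n"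
  assume pq: "sides_within U (2 * U) p q" and ab: "sides_ge (?L * U) a b"
  \<comment> \<open>The small box lies within \<open>R + 2 * CARD('n) * U\<close> of
    \<open>x\<close>, and \<open>R + T \<le> U\<close> leaves room for the patches
    themselves.\<close>
  define T' where "T' = (1 + 2 * CARD('n)) * U"
  have U0: "0 < U" using U R_pos T_pos by linarith
  have "1 * U \<le> T'" unfolding T'_def using U0 by (intro mult_right_mono) auto
  then have "T1 \<le> T'" using U by simp
  note rep' = rep[OF this]
  obtain x where x: "x \<in> X" "dist p x \<le> R" using X_dense by blast
  define m where "m = (1 / 2) *\<^sub>R (a + b)"
  obtain x' where x': "x' \<in> X" "dist m x' \<le> c * T'" "centered_patch X T' x' = centered_patch X T' x"
    using rep' x(1) unfolding repetitivity_bound_def by (metis IntE mem_cball)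
  define v where "v = x' - x"
  have "count_in ((\<lambda>y. y + (x' - x)) ` hobox p q) = count_in (hobox p q)"
  proof (rule count_transfer[OF x'(3)[symmetric]])
    fix y assume y: "y \<in> hobox p q"
    have "dist p y \<le> CARD('n) * (2 * U)"
      using hobox_subset_cball[of q p "2 * U"] y pq by (auto simp: sides_within_def)
    then have "dist x y \<le> R + CARD('n) * (2 * U)"
      using x(2) dist_triangle3[of x y p] by linarith
    then show "dist x y + T \<le> T'"
      using U by (simp add: T'_def algebra_simps)
  qed
  then have cnt: "count_in (hobox (p + v) (q + v)) = count_in (hobox p q)"
    unfolding hobox_translate v_def .
  have "a $ i + U \<le> (p + v) $ i \<and> (q + v) $ i + U \<le> b $ i" for i
  proof -
    have "\<bar>(x' - m) $ i\<bar> \<le> norm (x' - m)" "\<bar>(p - x) $ i\<bar> \<le> norm (p - x)"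
      by (rule component_le_norm_cart)+
    then have 1: "\<bar>x' $ i - m $ i\<bar> \<le> c * T'" "\<bar>p $ i - x $ i\<bar> \<le> R"
      using x(2) x'(2) by (auto simp: dist_norm norm_minus_commute)
    have 2: "U \<le> q $ i - p $ i" "q $ i - p $ i \<le> 2 * U" using pq by (auto simp: sides_within_def)
    \<comment> \<open>Half a side is at least \<open>c * T' + 4 * U\<close>: up to
      \<open>c * T'\<close> from \<open>m\<close> to \<open>x'\<close>, up to \<open>U\<close> on to
      the translated corner, up to \<open>2 * U\<close> across the small box, and the margin
      \<open>U\<close>.\<close>
    have "?L * U \<le> b $ i - a $ i" using ab by (simp add: sides_ge_def)
    moreover have "?L * U = 2 * (c * T') + 8 * U" by (simp add: T'_def algebra_simps)
    moreover have "m $ i = (a $ i + b $ i) / 2" by (simp add: m_def)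
    ultimately have 3: "c * T' + 4 * U \<le> b $ i - m $ i" "c * T' + 4 * U \<le> m $ i - a $ i"
      by (auto simp: field_simps)
    have 4: "R \<le> U" using U T_pos by linarith
    have 5: "(p + v) $ i = x' $ i + (p $ i - x $ i)" "(q + v) $ i = (p + v) $ i + (q $ i - p $ i)"
      by (auto simp: v_def)
    show ?thesis using 1 2 3 4 5 by linarith
  qed
  then show "\<exists>v. count_in (hobox (p + v) (q + v)) = count_in (hobox p q) \<and>
      (\<forall>i. a $ i + U \<le> (p + v) $ i \<and> (q + v) $ i + U \<le> b $ i)"
    using cnt by blast
qed

text \<open>\<open>T\<close> and \<open>P\<close> affect \<open>U0\<close>, \<open>f\<close> and the
  constants, but \<open>L\<close> and the exponent are fixed by \<open>c\<close> and the dimension: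
  one exponent serves all patches.\<close>

lemma linear_rate:
  fixes c :: real
  defines "L \<equiv> 2 * c * (1 + 2 * CARD('n)) + 8"
  defines "\<delta> \<equiv> - ln (1 - 1 / (2 * (2 * L) ^ CARD('n))) / ln L"
  assumes c: "0 < c" and rep: "\<And>T'. T1 \<le> T' \<Longrightarrow> repetitivity_bound X T' (c * T')"
  shows "0 < min (\<delta> / 2) (1 / 2)"
    and "\<exists>f C. \<forall>\<^sub>F U in at_top. \<forall>t. \<bar>patch_density X T P U t - f\<bar> \<le> C * U powr (- min (\<delta> / 2) (1 / 2))"
proof -
  define U0 where "U0 = max (R + T) T1"
  have U0: "0 < U0" using R_pos T_pos by (simp add: U0_def)
  have L: "2 \<le> L" using c by (simp add: L_def)
  then have "1 \<le> (2 * L) ^ CARD('n)" by (intro one_le_power) auto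
  then have "0 < 1 / (2 * (2 * L) ^ CARD('n))" "1 / (2 * (2 * L) ^ CARD('n)) \<le> 1 / 2"
    by (auto simp: field_simps)
  then have \<delta>: "0 < \<delta>" using L by (simp add: \<delta>_def divide_neg_pos)
  then show "0 < min (\<delta> / 2) (1 / 2)" by simp
  obtain G where G: "density_bounds (\<lambda>a b. count_in (hobox a b)) U0 0 G"
    using initial_density_bounds[OF U0] by blast
  have rec: "recurrent_boxes (\<lambda>a b. count_in (hobox a b)) L U" if "U0 \<le> U" for U
    unfolding L_def using that by (intro recurrent_boxes_count[of T1] rep) (auto simp: U0_def)
  obtain f C where "0 \<le> C" "\<And>s a b. U0 \<le> s \<Longrightarrow> sides_ge s a b \<Longrightarrow>
      \<bar>count_in (hobox a b) - f * box_vol a b\<bar> \<le> C * s powr (- \<delta>) * box_vol a b"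
    using density_rate[OF box_additive_count U0 L rec G] unfolding \<delta>_def by blast
  from ball_rate_from_boxes[OF \<delta> this(1) U0 this(2)]
  show "\<exists>f C. \<forall>\<^sub>F U in at_top. \<forall>t. \<bar>patch_density X T P U t - f\<bar> \<le> C * U powr (- min (\<delta> / 2) (1 / 2))"
    unfolding patch_density_eq by blast
qed

end

subsection \<open>Dense repetitivity\<close>

context delone_patch
begin

text \<open>Every patch already appears at one of the finitely many points of \<open>X\<close> in
  \<open>cball 0 M\<close>.\<close>

lemma finite_patches:
  assumes "repetitivity_bound X T' M"
  shows "finite (centered_patches X T')"
proof (rule finite_surj)
  show "finite (X \<inter> cball 0 M)" by (rule X.finite_bounded) simp
  show "centered_patches X T' \<subseteq> centered_patch X T' ` (X \<inter> cball 0 M)"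
    unfolding centered_patches_def
  proof (rule image_subsetI)
    fix y assume "y \<in> X"
    then show "centered_patch X T' y \<in> centered_patch X T' ` (X \<inter> cball 0 M)"
      using assms unfolding repetitivity_bound_def by (metis imageI)
  qed
qed

text \<open>The patch of radius \<open>U + T\<close> shows the full \<open>T\<close>-ball of each
  point in the \<open>U\<close>-ball, hence all occurrences there.\<close>

lemma patch_density_local:
  assumes "centered_patch X (U + T) x = centered_patch X (U + T) y"
  shows "patch_density X T P U x = patch_density X T P U y"
proof -
  have "(\<lambda>z. z + (y - x)) ` cball x U = cball y U"
    using cball_translation[of "y - x" x U] by (simp add: add.commute)
  then show ?thesis
    using count_transfer[OF assms, of "cball x U"] by (simp add: patch_density_eq)
qed

text \<open>Packing bounds the density, and a boundary layer of width 1 bounds its change under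
  small shifts. \<open>double_counting\<close> makes the density of a large ball the mean of the
  densities of its \<open>U\<close>-balls, with error of order \<open>U / V\<close>.\<close>

lemma patch_density_regular:
  obtains C where "0 < C"
    and "\<And>U t. 1 \<le> U \<Longrightarrow> \<bar>patch_density X T P U t\<bar> \<le> C"
    and "\<And>U s x. 1 \<le> U \<Longrightarrow> dist s x \<le> 1 \<Longrightarrow> \<bar>patch_density X T P U s - patch_density X T P U x\<bar> \<le> C / U"
    and "\<And>U V t. 1 \<le> U \<Longrightarrow> U \<le> V \<Longrightarrow>
      integrable lborel (\<lambda>z. indicator (cball t V) z * patch_density X T P U z)"
    and "\<And>U V t. 1 \<le> U \<Longrightarrow> U \<le> V \<Longrightarrow>
      \<bar>unit_ball_vol CARD('n) * V ^ CARD('n) * patch_density X T P V t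
        - (\<integral>z. indicator (cball t V) z * patch_density X T P U z \<partial>lborel)\<bar> \<le> C * U * V ^ (CARD('n) - 1)"
proof -
  let ?d = "CARD('n)"
  let ?\<kappa> = "unit_ball_vol (real ?d)"
  have \<kappa>: "0 < ?\<kappa>" by simp
  define Ca where "Ca = 4 * ?d * 3 ^ (?d - 1) / r ^ ?d"
  define C where "C = (2 / r) ^ ?d / ?\<kappa> + Ca / ?\<kappa> + Ca + 1"
  have Ca: "0 \<le> Ca" using r_pos by (simp add: Ca_def)
  have p1: "0 \<le> (2 / r) ^ ?d / ?\<kappa>" "0 \<le> Ca / ?\<kappa>"
    using r_pos Ca \<kappa> by (intro divide_nonneg_pos zero_le_power; simp)+
  have C: "0 < C" "(2 / r) ^ ?d / ?\<kappa> \<le> C" "Ca / ?\<kappa> \<le> C" "Ca \<le> C"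
    using p1 Ca unfolding C_def by linarith+
  have vol: "0 < ?\<kappa> * U ^ ?d" if "1 \<le> U" for U :: real
    using that by simp
  have "\<bar>patch_density X T P U t\<bar> \<le> C" if U: "1 \<le> U" for U t
  proof -
    have "count_in (cball t U) \<le> ((U + r) / r) ^ ?d"
      using U by (intro count_cball_le) simp
    also have "\<dots> \<le> (2 / r * U) ^ ?d"
      using U r_pos r_le_1 by (intro power_mono) (auto simp: field_simps)
    also have "\<dots> = (2 / r) ^ ?d * U ^ ?d" by (rule power_mult_distrib)
    finally have "patch_density X T P U t \<le> (2 / r) ^ ?d * U ^ ?d / (?\<kappa> * U ^ ?d)"
      unfolding patch_density_eq using vol[OF U] by (intro divide_right_mono) auto
    also have "\<dots> = (2 / r) ^ ?d / ?\<kappa>" using U by simp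
    also note C(2)
    finally show ?thesis
      using vol[OF U] by (simp add: patch_density_eq)
  qed
  moreover have "\<bar>patch_density X T P U s - patch_density X T P U x\<bar> \<le> C / U"
    if U: "1 \<le> U" and sx: "dist s x \<le> 1" for U s x
  proof -
    have sub: "cball s U \<subseteq> cball x U \<union> annulus x U 1" "cball x U \<subseteq> cball s U \<union> annulus x U 1"
    proof -
      have tri: "dist x y \<le> dist s x + dist s y" "dist s y \<le> dist s x + dist x y" for y
        by (rule dist_triangle3, rule dist_triangle)
      have "y \<in> cball x U \<union> annulus x U 1" if "y \<in> cball s U" for y
        using tri(1)[of y] sx that by (auto simp: annulus_def)
      then show "cball s U \<subseteq> cball x U \<union> annulus x U 1" by blast
      have "y \<in> cball s U \<union> annulus x U 1" if "y \<in> cball x U" for y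
        using tri(2)[of y] sx that by (auto simp: annulus_def)
      then show "cball x U \<subseteq> cball s U \<union> annulus x U 1" by blast
    qed
    have "annulus x U 1 \<subseteq> cball x (U + 1)" by (auto simp: annulus_def)
    then have bd: "bounded (annulus x U 1)" using bounded_cball bounded_subset by blast
    have "count_in A \<le> count_in B + count_in (annulus x U 1)"
      if "A \<subseteq> B \<union> annulus x U 1" "bounded B" for A B
    proof -
      have "count_in A \<le> count_in (B \<union> annulus x U 1)"
        using that bd by (intro count_mono) auto
      also have "\<dots> \<le> count_in B + count_in (annulus x U 1)"
        using card_Un_le[of "occ \<inter> B" "occ \<inter> annulus x U 1"]
        by (simp add: Int_Un_distrib flip: of_nat_add)
      finally show ?thesis .
    qed
    from this[OF sub(1)] this[OF sub(2)]
    have "\<bar>count_in (cball s U) - count_in (cball x U)\<bar> \<le> count_in (annulus x U 1)" by simp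
    also have "\<dots> \<le> Ca * 1 * U ^ (?d - 1)"
      unfolding Ca_def using U by (intro annulus_count_le) auto
    finally have "\<bar>count_in (cball s U) - count_in (cball x U)\<bar> / (?\<kappa> * U ^ ?d)
        \<le> Ca * 1 * U ^ (?d - 1) / (?\<kappa> * U ^ ?d)"
      using vol[OF U] by (intro divide_right_mono) auto
    also have "\<dots> = Ca / ?\<kappa> / U"
    proof -
      have "U ^ ?d = U * U ^ (?d - 1)"
        by (rule power_card_eq)
      then show ?thesis using U by simp
    qed
    also have "\<dots> \<le> C / U" using C(3) U by (intro divide_right_mono) auto
    finally show ?thesis
      using vol[OF U] by (simp add: patch_density_eq abs_divide flip: diff_divide_distrib)
  qed
  moreover have "integrable lborel (\<lambda>z. indicator (cball t V) z * patch_density X T P U z) \<and>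
      \<bar>?\<kappa> * V ^ ?d * patch_density X T P V t
        - (\<integral>z. indicator (cball t V) z * patch_density X T P U z \<partial>lborel)\<bar> \<le> C * U * V ^ (?d - 1)"
    if U: "1 \<le> U" "U \<le> V" for U V t
  proof -
    let ?k = "?\<kappa> * U ^ ?d"
    have k: "0 < ?k" by (rule vol[OF U(1)])
    \<comment> \<open>\<open>cball 0 U\<close> is symmetric, so the translations hitting
      \<open>x\<close> and the points hit by \<open>z\<close> both form balls.\<close>
    have eq: "{z. x - z \<in> cball 0 U} = cball x U" "{z. z - x \<in> cball 0 U} = cball x U" for x :: "real ^ 'n"
      by (auto simp: dist_norm norm_minus_commute)
    define I where "I = (\<lambda>z. indicator (cball t V) z * count_in (cball z U))"
    have dc: "integrable lborel I"
      "\<bar>?k * count_in (cball t V) - (\<integral>z. I z \<partial>lborel)\<bar> \<le> ?k * count_in (annulus t V U)"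
      using double_counting[of "cball 0 U" ?k U V t] U
      unfolding I_def eq by (auto simp: content_cball)
    have I: "indicator (cball t V) z * patch_density X T P U z = I z / ?k" for z
      by (simp add: I_def patch_density_eq)
    have "\<bar>count_in (cball t V) - (\<integral>z. I z \<partial>lborel) / ?k\<bar>
        = \<bar>?k * count_in (cball t V) - (\<integral>z. I z \<partial>lborel)\<bar> / ?k"
    proof -
      have "count_in (cball t V) - (\<integral>z. I z \<partial>lborel) / ?k
          = (?k * count_in (cball t V) - (\<integral>z. I z \<partial>lborel)) / ?k"
        by (simp only: diff_divide_distrib nonzero_mult_div_cancel_left[OF less_imp_neq[OF k, symmetric]])
      then show ?thesis using k by (simp only: abs_divide abs_of_pos)
    qed
    also have "\<dots> \<le> ?k * count_in (annulus t V U) / ?k"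
      using dc(2) k by (intro divide_right_mono) auto
    also have "\<dots> = count_in (annulus t V U)"
      by (rule nonzero_mult_div_cancel_left[OF less_imp_neq[OF k, symmetric]])
    also have "\<dots> \<le> Ca * U * V ^ (?d - 1)"
      unfolding Ca_def using U by (intro annulus_count_le) auto
    also have "\<dots> \<le> C * U * V ^ (?d - 1)"
      using C(4) U by (intro mult_right_mono) auto
    finally have "\<bar>count_in (cball t V) - (\<integral>z. I z \<partial>lborel) / ?k\<bar> \<le> C * U * V ^ (?d - 1)" .
    moreover have "?\<kappa> * V ^ ?d * patch_density X T P V t = count_in (cball t V)"
    proof -
      have "?\<kappa> * V ^ ?d \<noteq> 0" using vol[of V] U by (metis less_irrefl order_trans)
      then show ?thesis
        unfolding patch_density_eq times_divide_eq_right by (rule nonzero_mult_div_cancel_left)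
    qed
    ultimately show ?thesis
      unfolding I using dc(1) by simp
  qed
  ultimately show thesis using that C(1) by blast
qed

text \<open>\<open>a\<close> is the limit of the suprema over all centres. With
  \<open>\<sigma> = -1\<close> it is minus the lower density, so both extremes are treated at
  once.\<close>

definition is_upper_density :: "real \<Rightarrow> real \<Rightarrow> bool" where
  "is_upper_density \<sigma> a \<longleftrightarrow>
     (\<forall>\<epsilon>>0. \<forall>\<^sub>F U in at_top. \<forall>t. \<sigma> * patch_density X T P U t \<le> a + \<epsilon>) \<and>
     (\<forall>\<epsilon>>0. \<forall>U\<ge>1. \<exists>t. a - \<epsilon> < \<sigma> * patch_density X T P U t)"

text \<open>As in Fekete's lemma, the infimum over all radii is the limit: by averaging, a large
  ball is hardly denser than the densest ball of a given smaller radius.\<close>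

lemma upper_density_exists:
  assumes \<sigma>: "\<bar>\<sigma>\<bar> = 1"
  shows "\<exists>a. is_upper_density \<sigma> a"
proof -
  let ?d = "CARD('n)"
  let ?\<kappa> = "unit_ball_vol (real ?d)"
  have \<kappa>: "0 < ?\<kappa>" by simp
  obtain C where C: "0 < C"
    and bd: "\<And>U t. 1 \<le> U \<Longrightarrow> \<bar>patch_density X T P U t\<bar> \<le> C"
    and int: "\<And>U V t. 1 \<le> U \<Longrightarrow> U \<le> V \<Longrightarrow>
      integrable lborel (\<lambda>z. indicator (cball t V) z * patch_density X T P U z)"
    and avg: "\<And>U V t. 1 \<le> U \<Longrightarrow> U \<le> V \<Longrightarrow>
      \<bar>?\<kappa> * V ^ ?d * patch_density X T P V t
        - (\<integral>z. indicator (cball t V) z * patch_density X T P U z \<partial>lborel)\<bar> \<le> C * U * V ^ (?d - 1)"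
    by - (rule patch_density_regular, rule that; blast)
  define A where "A = {a. \<exists>U\<ge>1. \<forall>t. \<sigma> * patch_density X T P U t \<le> a}"
  define a where "a = Inf A"
  have abs: "\<bar>\<sigma> * patch_density X T P U t\<bar> \<le> C" if "1 \<le> U" for U t
    using bd[OF that, of t] \<sigma> by (simp add: abs_mult)
  have "C \<in> A" unfolding A_def using abs abs_le_D1 by blast
  have "- C \<le> b" if "b \<in> A" for b
  proof -
    obtain U where "1 \<le> U" "\<sigma> * patch_density X T P U 0 \<le> b" using \<open>b \<in> A\<close> by (auto simp: A_def)
    then show ?thesis using abs[of U 0] by linarith
  qed
  then have bb: "bdd_below A" by (rule bdd_belowI)
  have "\<forall>\<^sub>F V in at_top. \<forall>t. \<sigma> * patch_density X T P V t \<le> a + \<epsilon>" if \<epsilon>: "0 < \<epsilon>" for \<epsilon>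
  proof -
    obtain b where b: "b \<in> A" "b < a + \<epsilon> / 2"
      using cInf_lessD[of A "a + \<epsilon> / 2"] \<open>C \<in> A\<close> \<epsilon> by (auto simp: a_def)
    then obtain U where U: "1 \<le> U" "\<And>t. \<sigma> * patch_density X T P U t \<le> b" by (auto simp: A_def)
    \<comment> \<open>Large \<open>V\<close> brings the boundary term below
      \<open>\<epsilon> / 2\<close> per volume; the other half is the slack in the choice of
      \<open>b\<close>.\<close>
    have "\<sigma> * patch_density X T P V t \<le> a + \<epsilon>" if V: "max U (2 * C * U / (?\<kappa> * \<epsilon>)) \<le> V" for V t
    proof -
      have V1: "1 \<le> V" "U \<le> V" using V U by auto
      have vol: "0 < ?\<kappa> * V ^ ?d" using V1 by simp
      have "(\<integral>z. \<sigma> * (indicator (cball t V) z * patch_density X T P U z) \<partial>lborel)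
          \<le> (\<integral>z. indicator (cball t V) z * b \<partial>lborel)"
        using U(2) by (intro integral_mono integrable_mult_right int U V1 integral_cball_const)
          (auto simp: indicator_def)
      then have "\<sigma> * (\<integral>z. indicator (cball t V) z * patch_density X T P U z \<partial>lborel) \<le> ?\<kappa> * V ^ ?d * b"
        using V1 by (simp add: content_cball)
      moreover have "\<sigma> * (?\<kappa> * V ^ ?d * patch_density X T P V t)
          - \<sigma> * (\<integral>z. indicator (cball t V) z * patch_density X T P U z \<partial>lborel) \<le> C * U * V ^ (?d - 1)"
      proof -
        have "\<bar>\<sigma> * (?\<kappa> * V ^ ?d * patch_density X T P V t
            - (\<integral>z. indicator (cball t V) z * patch_density X T P U z \<partial>lborel))\<bar> \<le> C * U * V ^ (?d - 1)"
          unfolding abs_mult \<sigma> using avg[OF U(1) V1(2)] by simp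
        then show ?thesis by (simp add: right_diff_distrib)
      qed
      moreover have "C * U * V ^ (?d - 1) \<le> ?\<kappa> * V ^ ?d * (\<epsilon> / 2)"
      proof -
        have "2 * C * U / (?\<kappa> * \<epsilon>) \<le> V" using V by simp
        then have "2 * C * U \<le> V * (?\<kappa> * \<epsilon>)"
          using \<kappa> \<epsilon> by (simp only: pos_divide_le_eq mult_pos_pos)
        then have "C * U * V ^ (?d - 1) \<le> (V * ?\<kappa> * (\<epsilon> / 2)) * V ^ (?d - 1)"
          using V1 by (intro mult_right_mono) auto
        also have "\<dots> = ?\<kappa> * (V * V ^ (?d - 1)) * (\<epsilon> / 2)" by (simp only: mult_ac)
        also have "V * V ^ (?d - 1) = V ^ ?d"
          by (rule power_card_eq[symmetric])
        finally show ?thesis .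
      qed
      ultimately have "?\<kappa> * V ^ ?d * (\<sigma> * patch_density X T P V t) \<le> ?\<kappa> * V ^ ?d * (b + \<epsilon> / 2)"
        by (simp add: distrib_left mult_ac)
      then have "\<sigma> * patch_density X T P V t \<le> b + \<epsilon> / 2"
        using vol by (simp only: mult_le_cancel_left_pos)
      then show ?thesis using b(2) by simp
    qed
    then show ?thesis unfolding eventually_at_top_linorder by blast
  qed
  moreover have "\<exists>t. a - \<epsilon> < \<sigma> * patch_density X T P U t" if "0 < \<epsilon>" "1 \<le> U" for \<epsilon> U
  proof (rule ccontr)
    assume "\<not> ?thesis"
    then have "a - \<epsilon> \<in> A" using that by (auto simp: A_def not_less)
    then have "a \<le> a - \<epsilon>" unfolding a_def using bb by (rule cInf_lower)
    then show False using that by simp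
  qed
  ultimately show ?thesis unfolding is_upper_density_def by blast
qed

text \<open>Radius \<open>U + T\<close>, because by \<open>patch_density_local\<close> the density
  of the \<open>U\<close>-ball is then a function of the patch.\<close>

definition low_patches :: "real \<Rightarrow> real \<Rightarrow> real \<Rightarrow> (real ^ 'n) set set" where
  "low_patches \<sigma> b U = centered_patch X (U + T) ` {x \<in> X. \<sigma> * patch_density X T P U x < b}"

text \<open>A ball \<open>cball t V\<close> whose density is close to the upper density leaves room only for few balls
  \<open>cball x U\<close> of low density, while dense repetitivity makes all patches of radius \<open>U + T\<close>
  occur in it about equally often.\<close>

lemma few_low_patches:
  fixes c :: real
  assumes \<sigma>: "\<bar>\<sigma>\<bar> = 1" and a: "is_upper_density \<sigma> a" and D: "0 < D" and c: "0 < c"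
    and rep: "\<And>T'. T1 \<le> T' \<Longrightarrow>
      \<exists>M. repetitivity_bound X T' M \<and> M ^ CARD('n) \<le> c * patch_count X T'"
  shows "\<forall>\<^sub>F U in at_top. 3 * card (low_patches \<sigma> (a - D) U) \<le> patch_count X (U + T)"
proof -
  let ?d = "CARD('n)"
  let ?\<kappa> = "unit_ball_vol (real ?d)"
  have \<kappa>: "0 < ?\<kappa>" by simp
  obtain C where C: "0 < C"
    and lip: "\<And>U s x. 1 \<le> U \<Longrightarrow> dist s x \<le> 1 \<Longrightarrow>
      \<bar>patch_density X T P U s - patch_density X T P U x\<bar> \<le> C / U"
    and int: "\<And>U V t. 1 \<le> U \<Longrightarrow> U \<le> V \<Longrightarrow>
      integrable lborel (\<lambda>z. indicator (cball t V) z * patch_density X T P U z)"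
    and avg: "\<And>U V t. 1 \<le> U \<Longrightarrow> U \<le> V \<Longrightarrow>
      \<bar>?\<kappa> * V ^ ?d * patch_density X T P V t
        - (\<integral>z. indicator (cball t V) z * patch_density X T P U z \<partial>lborel)\<bar> \<le> C * U * V ^ (?d - 1)"
    by - (rule patch_density_regular, rule that; blast)
  \<comment> \<open>Makes the final fraction one third: 18 is \<open>2 * 3 * 3\<close>, from the
    loss \<open>D / 2\<close>, three slacks \<open>\<epsilon>\<close> and the third itself;
    \<open>2 ^ ?d\<close> comes from \<open>V / (2 * M)\<close>.\<close>
  define \<epsilon> where "\<epsilon> = D * r ^ ?d / (18 * 2 ^ ?d * c)"
  have \<epsilon>: "0 < \<epsilon>" using D r_pos c by (simp add: \<epsilon>_def)
  have ev: "\<forall>\<^sub>F U in at_top. \<forall>t. \<sigma> * patch_density X T P U t \<le> a + \<epsilon>"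
    and ex: "\<And>V. 1 \<le> V \<Longrightarrow> \<exists>t. a - \<epsilon> < \<sigma> * patch_density X T P V t"
    using a \<epsilon> by (auto simp: is_upper_density_def)
  have "3 * card (low_patches \<sigma> (a - D) U) \<le> patch_count X (U + T)"
    if up: "\<forall>t. \<sigma> * patch_density X T P U t \<le> a + \<epsilon>" and U: "max 1 (max T1 (2 * C / D)) \<le> U" for U
  proof -
    have U1: "1 \<le> U" "T1 \<le> U + T" "C / U \<le> D / 2"
      using U D T_pos by (auto simp: field_simps)
    obtain M where M: "repetitivity_bound X (U + T) M" "M ^ ?d \<le> c * patch_count X (U + T)"
      using rep[OF U1(2)] by blast
    have M0: "0 < M" using M(1) by (simp add: repetitivity_bound_def)
    define \<beta> where "\<beta> = low_patches \<sigma> (a - D) U"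
    have \<beta>: "\<beta> \<subseteq> centered_patches X (U + T)"
      by (auto simp: \<beta>_def low_patches_def centered_patches_def)
    have fin\<beta>: "finite \<beta>" by (rule finite_subset[OF \<beta> finite_patches[OF M(1)]])
    \<comment> \<open>The bounds serve, in turn, the averaging, the estimate
      \<open>V / (2 * M) \<le> (V - r - M) / M\<close>, and a boundary term of at most
      \<open>\<epsilon>\<close> per volume.\<close>
    define V where "V = max U (max (2 * (M + 1)) (C * U / (?\<kappa> * \<epsilon>)))"
    have V: "U \<le> V" "2 * (M + 1) \<le> V" "C * U / (?\<kappa> * \<epsilon>) \<le> V"
      unfolding V_def by linarith+
    have V1: "1 \<le> V" using V U1 by simp
    obtain t where t: "a - \<epsilon> < \<sigma> * patch_density X T P V t" using ex[OF V1] by blast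
    \<comment> \<open>Radius \<open>V - r\<close> keeps the balls of radius \<open>r\<close> about
      these points inside \<open>cball t V\<close>.\<close>
    define Yp where "Yp = (\<lambda>p. {y \<in> X \<inter> cball t (V - r). centered_patch X (U + T) y = p})"
    define Y where "Y = (\<Union>p\<in>\<beta>. Yp p)"
    have YX: "Yp p \<subseteq> X \<inter> cball t (V - r)" for p by (auto simp: Yp_def)
    have finYp: "finite (Yp p)" for p
      by (rule finite_subset[OF YX X.finite_bounded]) simp
    have finY: "finite Y" unfolding Y_def using fin\<beta> finYp by simp
    have "real (card \<beta>) * (V / (2 * M)) ^ ?d \<le> (\<Sum>p\<in>\<beta>. card (Yp p))"
    proof -
      have "(V / (2 * M)) ^ ?d \<le> card (Yp p)" if "p \<in> \<beta>" for p
      proof -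
        obtain x where x: "x \<in> X" "p = centered_patch X (U + T) x"
          using \<open>p \<in> \<beta>\<close> by (auto simp: \<beta>_def low_patches_def)
        have "V / (2 * M) \<le> (V - r - M) / M"
          using V M0 r_le_1 by (simp add: field_simps)
        then have "(V / (2 * M)) ^ ?d \<le> ((V - r - M) / M) ^ ?d"
          using V1 M0 by (intro power_mono) auto
        also have "\<dots> \<le> card (Yp p)"
          unfolding Yp_def x(2) using V(2) r_le_1 M0 by (intro patch_frequent M(1) x(1)) simp
        finally show ?thesis .
      qed
      then have "(\<Sum>p\<in>\<beta>. (V / (2 * M)) ^ ?d) \<le> (\<Sum>p\<in>\<beta>. real (card (Yp p)))"
        by (rule sum_mono)
      then show ?thesis by simp
    qed
    also have "(\<Sum>p\<in>\<beta>. card (Yp p)) = card Y"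
      unfolding Y_def using fin\<beta> finYp by (intro card_UN_disjoint[symmetric]) (auto simp: Yp_def)
    finally have cardY: "real (card \<beta>) * (V / (2 * M)) ^ ?d \<le> card Y" .
    have low: "\<sigma> * patch_density X T P U y < a - D" if "y \<in> Y" for y
    proof -
      have "centered_patch X (U + T) y \<in> low_patches \<sigma> (a - D) U"
        using that by (auto simp: Y_def Yp_def \<beta>_def)
      then obtain x where x: "\<sigma> * patch_density X T P U x < a - D"
          "centered_patch X (U + T) y = centered_patch X (U + T) x"
        unfolding low_patches_def by blast
      then show ?thesis using patch_density_local[OF x(2)] by simp
    qed
    define E where "E = (\<Union>y\<in>Y. ball y r)"
    have YsubX: "Y \<subseteq> X" using YX by (auto simp: Y_def)
    have E: "measure lborel E = card Y * (?\<kappa> * r ^ ?d)"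
      unfolding E_def by (rule X.measure_disjoint_balls[OF finY YsubX])
    have EB: "E \<subseteq> cball t V"
    proof -
      have "ball y r \<subseteq> cball t V" if "y \<in> Y" for y
      proof -
        have "dist t y \<le> V - r" using that by (auto simp: Y_def Yp_def)
        then show ?thesis by (simp add: ball_subset_cball_iff dist_commute)
      qed
      then show ?thesis by (auto simp: E_def)
    qed
    have "open E" by (auto simp: E_def)
    then have fmE: "E \<in> fmeasurable lborel"
      using bounded_subset[OF bounded_cball EB] by (intro fmeasurable_lborel_bounded) auto
    have intE: "integrable lborel (\<lambda>z. D / 2 * indicator E z :: real)"
      using fmE by (intro integrable_mult_right integrable_real_indicator) (auto simp: fmeasurable_def)
    \<comment> \<open>A point of \<open>E\<close> is within 1 of some low \<open>y\<close>, so its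
      density exceeds that at \<open>y\<close> by at most \<open>C / U \<le> D / 2\<close>; half of
      the gap \<open>D\<close> survives.\<close>
    have pointwise: "\<sigma> * (indicator (cball t V) z * patch_density X T P U z)
        \<le> indicator (cball t V) z * (a + \<epsilon>) - D / 2 * indicator E z" for z
    proof (cases "z \<in> E")
      case True
      then obtain y where y: "y \<in> Y" "dist z y \<le> 1" using r_le_1 by (auto simp: E_def dist_commute)
      have "\<bar>\<sigma> * (patch_density X T P U z - patch_density X T P U y)\<bar> \<le> C / U"
        unfolding abs_mult \<sigma> using lip[OF U1(1) y(2)] by simp
      then have "\<sigma> * patch_density X T P U z \<le> \<sigma> * patch_density X T P U y + C / U"
        by (simp add: right_diff_distrib abs_le_iff)
      then have "\<sigma> * patch_density X T P U z \<le> a + \<epsilon> - D / 2"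
        using low[OF y(1)] U1(3) \<epsilon> by linarith
      then show ?thesis using True EB by (auto simp: indicator_def)
    next
      case False
      then show ?thesis using up by (auto simp: indicator_def)
    qed
    have "(\<integral>z. \<sigma> * (indicator (cball t V) z * patch_density X T P U z) \<partial>lborel)
        \<le> (\<integral>z. indicator (cball t V) z * (a + \<epsilon>) - D / 2 * indicator E z \<partial>lborel)"
      by (intro integral_mono integrable_mult_right Bochner_Integration.integrable_diff int U1 V
          integral_cball_const intE pointwise)
    also have "\<dots> = ?\<kappa> * V ^ ?d * (a + \<epsilon>) - D / 2 * measure lborel E"
      using V1 by (subst Bochner_Integration.integral_diff[OF integral_cball_const(1) intE])
        (simp add: content_cball)
    finally have "\<sigma> * (\<integral>z. indicator (cball t V) z * patch_density X T P U z \<partial>lborel)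
        \<le> ?\<kappa> * V ^ ?d * (a + \<epsilon>) - D / 2 * measure lborel E" by simp
    moreover have "\<sigma> * (?\<kappa> * V ^ ?d * patch_density X T P V t)
        - \<sigma> * (\<integral>z. indicator (cball t V) z * patch_density X T P U z \<partial>lborel) \<le> C * U * V ^ (?d - 1)"
    proof -
      have "\<bar>\<sigma> * (?\<kappa> * V ^ ?d * patch_density X T P V t
          - (\<integral>z. indicator (cball t V) z * patch_density X T P U z \<partial>lborel))\<bar> \<le> C * U * V ^ (?d - 1)"
        unfolding abs_mult \<sigma> using avg[OF U1(1) V(1)] by simp
      then show ?thesis by (simp add: right_diff_distrib)
    qed
    moreover have "?\<kappa> * V ^ ?d * (a - \<epsilon>) \<le> \<sigma> * (?\<kappa> * V ^ ?d * patch_density X T P V t)"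
    proof -
      have "?\<kappa> * V ^ ?d * (a - \<epsilon>) \<le> ?\<kappa> * V ^ ?d * (\<sigma> * patch_density X T P V t)"
        using t V1 \<kappa> by (intro mult_left_mono) auto
      then show ?thesis by (simp only: mult_ac)
    qed
    moreover have "C * U * V ^ (?d - 1) \<le> ?\<kappa> * V ^ ?d * \<epsilon>"
    proof -
      have "C * U \<le> V * (?\<kappa> * \<epsilon>)"
        using V(3) \<kappa> \<epsilon> by (simp only: pos_divide_le_eq mult_pos_pos)
      then have "C * U * V ^ (?d - 1) \<le> (V * (?\<kappa> * \<epsilon>)) * V ^ (?d - 1)"
        using V1 by (intro mult_right_mono) auto
      also have "\<dots> = ?\<kappa> * (V * V ^ (?d - 1)) * \<epsilon>" by (simp only: mult_ac)
      also have "V * V ^ (?d - 1) = V ^ ?d"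
        by (rule power_card_eq[symmetric])
      finally show ?thesis .
    qed
    moreover have "?\<kappa> * V ^ ?d * (a + \<epsilon>) = ?\<kappa> * V ^ ?d * (a - \<epsilon>) + 2 * (?\<kappa> * V ^ ?d * \<epsilon>)"
      by (simp add: algebra_simps)
    \<comment> \<open>Two \<open>\<epsilon>\<close> separate \<open>a + \<epsilon>\<close> from
      \<open>a - \<epsilon>\<close>, the third is the boundary term.\<close>
    ultimately have "D / 2 * measure lborel E \<le> 3 * (?\<kappa> * V ^ ?d * \<epsilon>)" by linarith
    then have "?\<kappa> * (D / 2 * (card Y * r ^ ?d)) \<le> ?\<kappa> * (3 * (V ^ ?d * \<epsilon>))"
      unfolding E by (simp only: mult_ac)
    then have "D / 2 * (card Y * r ^ ?d) \<le> 3 * (V ^ ?d * \<epsilon>)"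
      using \<kappa> by (simp only: mult_le_cancel_left_pos)
    moreover have "D / 2 * (real (card \<beta>) * (V / (2 * M)) ^ ?d * r ^ ?d) \<le> D / 2 * (card Y * r ^ ?d)"
      using D r_pos cardY by (intro mult_left_mono mult_right_mono) auto
    ultimately have *: "D / 2 * (real (card \<beta>) * (V / (2 * M)) ^ ?d * r ^ ?d) \<le> 3 * (V ^ ?d * \<epsilon>)"
      by linarith
    have "(V / (2 * M)) ^ ?d = V ^ ?d / (2 ^ ?d * M ^ ?d)"
      by (simp add: power_divide power_mult_distrib)
    then have "V ^ ?d * (D * r ^ ?d * card \<beta>) \<le> V ^ ?d * (6 * \<epsilon> * 2 ^ ?d * M ^ ?d)"
      using * M0 by (simp add: field_simps)
    then have "D * r ^ ?d * card \<beta> \<le> 6 * \<epsilon> * 2 ^ ?d * M ^ ?d"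
      using V1 by simp
    also have "\<dots> \<le> 6 * \<epsilon> * 2 ^ ?d * (c * patch_count X (U + T))"
      using M(2) \<epsilon> by (intro mult_left_mono) auto
    also have "\<dots> = D * r ^ ?d * (patch_count X (U + T) / 3)"
      using c by (simp add: \<epsilon>_def field_simps)
    finally have "card \<beta> \<le> real (patch_count X (U + T)) / 3"
      using D r_pos by (simp add: mult_le_cancel_left)
    then show ?thesis unfolding \<beta>_def by linarith
  qed
  then show ?thesis
    using eventually_conj[OF ev eventually_ge_at_top[of "max 1 (max T1 (2 * C / D))"]]
    by (auto elim: eventually_mono)
qed

text \<open>If upper and lower density differed, at most two thirds of the patches would be low for
  one of the two signs. A remaining patch would have a density both near the maximum and near the
  minimum.\<close>

lemma dense_frequency:
  fixes c :: real
  assumes c: "0 < c"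
    and rep: "\<And>T'. T1 \<le> T' \<Longrightarrow>
      \<exists>M. repetitivity_bound X T' M \<and> M ^ CARD('n) \<le> c * patch_count X T'"
  shows "\<exists>f. has_patch_frequency X T P f"
proof -
  obtain a where a: "is_upper_density 1 a" using upper_density_exists[of 1] by auto
  obtain a' where a': "is_upper_density (-1) a'" using upper_density_exists[of "-1"] by auto
  have "a + a' \<le> 0"
  proof (rule ccontr)
    assume "\<not> a + a' \<le> 0"
    then have pos: "0 < a + a'" by simp
    \<comment> \<open>A patch low for neither sign has density between \<open>a - D\<close> and
      \<open>D - a'\<close>, so \<open>a + a' \<le> 2 * D\<close>, which a third of
      \<open>a + a'\<close> contradicts.\<close>
    define D where "D = (a + a') / 3"
    have D: "0 < D" using pos by (simp add: D_def)
    have "\<forall>\<^sub>F U in at_top. 3 * card (low_patches 1 (a - D) U) \<le> patch_count X (U + T) \<and>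
        3 * card (low_patches (-1) (a' - D) U) \<le> patch_count X (U + T) \<and> max 1 T1 \<le> U"
      by (intro eventually_conj few_low_patches[OF _ a D c rep] few_low_patches[OF _ a' D c rep]
          eventually_ge_at_top) auto
    then obtain U where U: "3 * card (low_patches 1 (a - D) U) \<le> patch_count X (U + T)"
        "3 * card (low_patches (-1) (a' - D) U) \<le> patch_count X (U + T)" "max 1 T1 \<le> U"
      using eventually_happens'[of "at_top :: real filter"] by force
    obtain M where M: "repetitivity_bound X (U + T) M"
      using rep[of "U + T"] U(3) T_pos by auto
    note fin = finite_patches[OF M]
    obtain x0 where x0: "x0 \<in> X" using X_dense by blast
    then have "centered_patches X (U + T) \<noteq> {}" by (auto simp: centered_patches_def)
    then have N: "0 < patch_count X (U + T)" using fin by (simp add: patch_count_def card_gt_0_iff)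
    let ?L = "low_patches 1 (a - D) U \<union> low_patches (-1) (a' - D) U"
    have sub: "?L \<subseteq> centered_patches X (U + T)"
      by (auto simp: low_patches_def centered_patches_def)
    have "card ?L < card (centered_patches X (U + T))"
      using U N card_Un_le[of "low_patches 1 (a - D) U" "low_patches (-1) (a' - D) U"]
      unfolding patch_count_def by linarith
    then have "\<not> centered_patches X (U + T) \<subseteq> ?L"
      using card_mono[OF finite_subset[OF sub fin]] by (metis not_less)
    then obtain x where "x \<in> X" "centered_patch X (U + T) x \<notin> ?L"
      by (auto simp: centered_patches_def)
    then have "\<not> 1 * patch_density X T P U x < a - D" "\<not> (-1) * patch_density X T P U x < a' - D"
      unfolding low_patches_def by blast+
    then show False using D by (simp add: D_def field_simps)
  qed
  \<comment> \<open>The lower density is \<open>- a'\<close>, and \<open>a + a' \<le> 0\<close> puts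
    it at or above \<open>a\<close>; so \<open>a\<close> bounds the densities from both sides up to
    \<open>e / 2\<close>.\<close>
  have "has_patch_frequency X T P a"
    unfolding has_patch_frequency_def uniform_limit_iff
  proof (intro allI impI)
    fix e :: real assume "0 < e"
    then have e: "0 < e / 2" by simp
    have "\<forall>\<^sub>F U in at_top. (\<forall>t. 1 * patch_density X T P U t \<le> a + e / 2) \<and>
        (\<forall>t. (-1) * patch_density X T P U t \<le> a' + e / 2)"
      using a a' e unfolding is_upper_density_def by (intro eventually_conj) auto
    then show "\<forall>\<^sub>F U in at_top. \<forall>t\<in>UNIV. dist (patch_density X T P U t) a < e"
    proof eventually_elim
      case (elim U)
      show ?case
      proof
        fix t
        have "1 * patch_density X T P U t \<le> a + e / 2" "(-1) * patch_density X T P U t \<le> a' + e / 2"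
          using elim by blast+
        then show "dist (patch_density X T P U t) a < e"
          using \<open>a + a' \<le> 0\<close> \<open>0 < e\<close> unfolding dist_real_def by linarith
      qed
    qed
  qed
  then show ?thesis by blast
qed

end

subsection \<open>Delone sets\<close>

lemma repetitivity_bound_mono:
  assumes "repetitivity_bound X T M" "M \<le> M'"
  shows "repetitivity_bound X T M'"
  unfolding repetitivity_bound_def
proof (intro conjI allI ballI)
  show "0 < M'" using assms by (simp add: repetitivity_bound_def)
  fix c y assume "y \<in> X"
  then obtain x where "x \<in> X \<inter> cball c M" "centered_patch X T x = centered_patch X T y"
    using assms(1) unfolding repetitivity_bound_def by blast
  then show "\<exists>x\<in>X \<inter> cball c M'. centered_patch X T x = centered_patch X T y"
    using assms(2) by auto
qed

text \<open>\<open>r\<close> and \<open>R\<close> are chosen before \<open>T\<close> and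
  \<open>P\<close>. The ball condition gives distances at least \<open>r\<close>, so half of it
  meets the locale's \<open>2 * r\<close>.\<close>

lemma delone_patchI:
  assumes "delone_set X"
  obtains r R where "\<And>T P. 0 < T \<Longrightarrow> P \<in> centered_patches X T \<Longrightarrow> delone_patch X r R T P"
proof -
  obtain r R where r: "0 < r" and R: "0 < R"
    and sep: "\<And>c x y. x \<in> X \<inter> ball c r \<Longrightarrow> y \<in> X \<inter> ball c r \<Longrightarrow> x = y"
    and dense: "\<And>c. X \<inter> cball c R \<noteq> {}"
    using assms unfolding delone_set_def by blast
  have "delone_patch X (min (r / 2) 1) R T P" if "0 < T" "P \<in> centered_patches X T" for T P
  proof
    show "2 * min (r / 2) 1 \<le> dist x y" if "x \<in> X" "y \<in> X" "x \<noteq> y" for x y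
    proof -
      have "r \<le> dist x y" using sep[of x x y] that r by force
      then show ?thesis by linarith
    qed
    show "\<exists>x\<in>X. dist c x \<le> R" for c using dense[of c] by auto
  qed (use r R that in auto)
  then show thesis by (rule that)
qed

lemma linearly_repetitiveD:
  assumes "delone_set X" "linearly_repetitive X"
  obtains c T1 :: real where "0 < c" "\<And>T'. T1 \<le> T' \<Longrightarrow> repetitivity_bound X T' (c * T')"
proof -
  have rep: "repetitive X" and O: "repetitivity_function X \<in> O[at_top](\<lambda>T. T)"
    using assms(2) by (auto simp: linearly_repetitive_def)
  obtain c where c: "0 < c" "\<forall>\<^sub>F T in at_top. norm (repetitivity_function X T) \<le> c * norm T"
    using landau_o.bigE[OF O] by blast
  obtain T1 where T1: "\<And>T. T1 \<le> T \<Longrightarrow> norm (repetitivity_function X T) \<le> c * norm T"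
    using c(2) unfolding eventually_at_top_linorder by blast
  have "repetitivity_bound X T' (c * T')" if "max T1 1 \<le> T'" for T'
  proof (rule repetitivity_bound_mono)
    show "repetitivity_bound X T' (repetitivity_function X T')"
      using that by (intro repetitivity_function_least assms rep) auto
    show "repetitivity_function X T' \<le> c * T'"
      using T1[of T'] that by simp
  qed
  with c(1) show thesis by (rule that)
qed

lemma densely_repetitiveD:
  fixes X :: "(real ^ 'n) set"
  assumes "delone_set X" "densely_repetitive X"
  obtains c T1 :: real where "0 < c"
    "\<And>T'. T1 \<le> T' \<Longrightarrow> \<exists>M. repetitivity_bound X T' M \<and> M ^ CARD('n) \<le> c * patch_count X T'"
proof -
  let ?d = "CARD('n)"
  have rep: "repetitive X"
    and O: "repetitivity_function X \<in> O[at_top](\<lambda>T. real (patch_count X T) powr (1 / real ?d))"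
    using assms(2) by (auto simp: densely_repetitive_def)
  obtain c where c: "0 < c" "\<forall>\<^sub>F T in at_top. norm (repetitivity_function X T)
      \<le> c * norm (real (patch_count X T) powr (1 / real ?d))"
    using landau_o.bigE[OF O] by blast
  obtain T1 where T1: "\<And>T. T1 \<le> T \<Longrightarrow> norm (repetitivity_function X T)
      \<le> c * norm (real (patch_count X T) powr (1 / real ?d))"
    using c(2) unfolding eventually_at_top_linorder by blast
  have "\<exists>M. repetitivity_bound X T' M \<and> M ^ ?d \<le> c ^ ?d * patch_count X T'"
    if T': "max T1 1 \<le> T'" for T'
  proof (intro exI conjI)
    let ?M = "repetitivity_function X T'"
    show M: "repetitivity_bound X T' ?M"
      using T' by (intro repetitivity_function_least assms rep) auto
    then have "0 \<le> ?M" by (simp add: repetitivity_bound_def)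
    moreover have "?M \<le> c * real (patch_count X T') powr (1 / real ?d)"
      using T1[of T'] T' by simp
    ultimately have "?M ^ ?d \<le> (c * real (patch_count X T') powr (1 / real ?d)) ^ ?d"
      by (intro power_mono)
    also have "\<dots> = c ^ ?d * (real (patch_count X T') powr (1 / real ?d)) ^ ?d"
      by (rule power_mult_distrib)
    \<comment> \<open>The value 0 is a separate case, as \<open>powr_realpow\<close> needs a
      positive base.\<close>
    also have "(real (patch_count X T') powr (1 / real ?d)) ^ ?d = patch_count X T'"
      by (cases "patch_count X T' = 0") (simp_all add: powr_powr flip: powr_realpow)
    finally show "?M ^ ?d \<le> c ^ ?d * patch_count X T'" .
  qed
  with zero_less_power[OF c(1), of ?d] show thesis by (rule that)
qed

lemma has_patch_frequency_unique:
  assumes "has_patch_frequency X T P f" "has_patch_frequency X T P g"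
  shows "f = g"
proof -
  have "((\<lambda>U. patch_density X T P U 0) \<longlongrightarrow> h) at_top" if "has_patch_frequency X T P h" for h
    using that unfolding has_patch_frequency_def by (rule tendsto_uniform_limitI) simp
  then show ?thesis
    using assms tendsto_unique trivial_limit_at_top_linorder by blast
qed

lemma has_patch_frequency_of_rate:
  assumes "0 < \<delta>"
    and rate: "\<forall>\<^sub>F U in at_top. \<forall>t. \<bar>patch_density X T P U t - f\<bar> \<le> C * U powr (- \<delta>)"
  shows "has_patch_frequency X T P f"
  unfolding has_patch_frequency_def uniform_limit_iff
proof (intro allI impI)
  fix e :: real assume e: "0 < e"
  have "((\<lambda>U. C * U powr (- \<delta>)) \<longlongrightarrow> C * 0) at_top"
    using assms(1) by (intro tendsto_mult tendsto_const tendsto_neg_powr filterlim_ident) auto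
  then have "\<forall>\<^sub>F U in at_top. C * U powr (- \<delta>) < e"
    using e by (intro order_tendstoD) auto
  with rate show "\<forall>\<^sub>F U in at_top. \<forall>t\<in>UNIV. dist (patch_density X T P U t) f < e"
    by eventually_elim (auto simp: dist_real_def intro: le_less_trans)
qed

theorem theorem6p1:
  fixes X :: "(real ^ 'n) set"
  assumes "delone_set X"
    and "linearly_repetitive X \<or> densely_repetitive X"
  shows "strict_uniform_patch_frequencies X \<and>
    (linearly_repetitive X \<longrightarrow>
      (\<exists>\<delta>>0. \<forall>T>0. \<forall>P \<in> centered_patches X T. \<forall>f. has_patch_frequency X T P f \<longrightarrow>
        (\<exists>C. \<forall>\<^sub>F U in at_top. \<forall>t. \<bar>patch_density X T P U t - f\<bar> \<le> C * U powr (- \<delta>))))"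
proof -
  obtain r R where dp: "\<And>T P. 0 < T \<Longrightarrow> P \<in> centered_patches X T \<Longrightarrow> delone_patch X r R T P"
    using delone_patchI[OF assms(1)] by blast
  have rep: "repetitive X"
    using assms(2) by (auto simp: linearly_repetitive_def densely_repetitive_def)
  obtain x0 where x0: "x0 \<in> X" using assms(1) unfolding delone_set_def by blast
  have lin: "\<exists>\<delta>>0. \<forall>T>0. \<forall>P\<in>centered_patches X T. \<exists>f C. \<forall>\<^sub>F U in at_top. \<forall>t.
      \<bar>patch_density X T P U t - f\<bar> \<le> C * U powr (- \<delta>)" if linear: "linearly_repetitive X"
  proof -
    obtain c T1 where c: "0 < c" "\<And>T'. T1 \<le> T' \<Longrightarrow> repetitivity_bound X T' (c * T')"
      using linearly_repetitiveD[OF assms(1) linear] by blast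
    \<comment> \<open>Positivity of the exponent is a fact of the locale, so some patch has to be
      supplied; the exponent does not depend on which.\<close>
    have "centered_patch X 1 x0 \<in> centered_patches X 1"
      using x0 by (simp add: centered_patches_def)
    from delone_patch.linear_rate(1)[OF dp[OF zero_less_one this] c]
    show ?thesis using delone_patch.linear_rate(2)[OF dp c] by blast
  qed
  have freq: "\<exists>f. has_patch_frequency X T P f" if TP: "0 < T" "P \<in> centered_patches X T" for T P
    using assms(2)
  proof
    assume "linearly_repetitive X"
    from lin[OF this] obtain \<delta> f C where "0 < \<delta>"
        "\<forall>\<^sub>F U in at_top. \<forall>t. \<bar>patch_density X T P U t - f\<bar> \<le> C * U powr (- \<delta>)"
      using TP by blast
    then show ?thesis using has_patch_frequency_of_rate by blast
  next
    assume dense: "densely_repetitive X"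
    obtain c T1 :: real where "0 < c"
        "\<And>T'. T1 \<le> T' \<Longrightarrow> \<exists>M. repetitivity_bound X T' M \<and> M ^ CARD('n) \<le> c * patch_count X T'"
      using densely_repetitiveD[OF assms(1) dense] by blast
    then show ?thesis by (rule delone_patch.dense_frequency[OF dp[OF TP]])
  qed
  have "f \<noteq> 0" if "0 < T" "P \<in> centered_patches X T" "has_patch_frequency X T P f" for T P f
  proof -
    obtain M where "repetitivity_bound X T M" using rep \<open>0 < T\<close> by (auto simp: repetitive_def)
    then show ?thesis using delone_patch.patch_frequency_pos[OF dp] that by blast
  qed
  then have "strict_uniform_patch_frequencies X"
    using freq by (auto simp: strict_uniform_patch_frequencies_def uniform_patch_frequencies_def)
  moreover have "\<exists>\<delta>>0. \<forall>T>0. \<forall>P \<in> centered_patches X T. \<forall>f. has_patch_frequency X T P f \<longrightarrow>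
        (\<exists>C. \<forall>\<^sub>F U in at_top. \<forall>t. \<bar>patch_density X T P U t - f\<bar> \<le> C * U powr (- \<delta>))"
    if linear: "linearly_repetitive X"
  proof -
    obtain \<delta> where \<delta>: "0 < \<delta>" "\<And>T P. 0 < T \<Longrightarrow> P \<in> centered_patches X T \<Longrightarrow> \<exists>f C. \<forall>\<^sub>F U in at_top. \<forall>t.
        \<bar>patch_density X T P U t - f\<bar> \<le> C * U powr (- \<delta>)"
      using lin[OF linear] by blast
    have "\<exists>C. \<forall>\<^sub>F U in at_top. \<forall>t. \<bar>patch_density X T P U t - f\<bar> \<le> C * U powr (- \<delta>)"
      if TP: "0 < T" "P \<in> centered_patches X T" and f: "has_patch_frequency X T P f" for T P f
    proof -
      obtain g C where g: "\<forall>\<^sub>F U in at_top. \<forall>t. \<bar>patch_density X T P U t - g\<bar> \<le> C * U powr (- \<delta>)"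
        using \<delta>(2)[OF TP] by blast
      \<comment> \<open>The rate forces convergence to \<open>g\<close>, and limits are unique; thus
        the rate holds for the given frequency \<open>f\<close>.\<close>
      then have "g = f"
        using has_patch_frequency_unique[OF has_patch_frequency_of_rate[OF \<delta>(1)] f] by blast
      then show ?thesis using g by blast
    qed
    then show ?thesis using \<delta>(1) by blast
  qed
  ultimately show ?thesis by blast
qed

end
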